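(* For every integer $n\geq 6$, $\mathrm{ex}_{\mathcal P}(n,F^{\mathrm{ind}})=3n-6$ if $F$ is one of the following graphs: (i) $C_k$, for any $k\geq 4$; (ii) $S_3$; (iii) $K_4$; (iv) $2K_3$.
   Context: All graphs are finite and simple. $C_k$ is the cycle on $k$ vertices, $S_k$ is the star with $k$ leaves (so it has $k+1$ vertices), $K_m$ is the complete graph on $m$ vertices, and $2K_3$ is the disjoint union of two triangles. A graph $G$ is $F^{\mathrm{ind}}$-free if it contains no induced subgraph isomorphic to $F$. The induced planar Turán number is $\mathrm{ex}_{\mathcal P}(n,F^{\mathrm{ind}}):=\max\{|E(G)| : G \text{ is an } n\text{-vertex planar graph that is } F^{\mathrm{ind}}\text{-free}\}$. *)

theory Defs
  imports "HOL-Analysis.Analysis"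
begin

section \<open>Finite simple graphs\<close>

record 'a ugraph =
  verts :: "'a set"
  edges :: "'a set set"

definition simple_graph :: "'a ugraph \<Rightarrow> bool" where
  "simple_graph G \<longleftrightarrow> finite (verts G) \<and> (\<forall>e\<in>edges G. e \<subseteq> verts G \<and> card e = 2)"

definition graph_iso :: "'a ugraph \<Rightarrow> 'b ugraph \<Rightarrow> bool" where
  "graph_iso G H \<longleftrightarrow>
     (\<exists>f. bij_betw f (verts G) (verts H) \<and>
          (\<forall>u\<in>verts G. \<forall>v\<in>verts G. {u, v} \<in> edges G \<longleftrightarrow> {f u, f v} \<in> edges H))"

definition induced :: "'a ugraph \<Rightarrow> 'a set \<Rightarrow> 'a ugraph" where
  "induced G S = \<lparr>verts = S, edges = {e \<in> edges G. e \<subseteq> S}\<rparr>"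

definition induced_free :: "'b ugraph \<Rightarrow> 'a ugraph \<Rightarrow> bool" where
  "induced_free F G \<longleftrightarrow> \<not> (\<exists>S\<subseteq>verts G. graph_iso (induced G S) F)"


section \<open>Planarity\<close>

text \<open>
  A drawing in the plane (identified with the complex numbers): vertices are distinct points, each
  edge is an arc (an injective continuous image of the unit interval) joining its two end vertices
  and passing through no other vertex, and distinct edges meet only in common end vertices.
\<close>

definition plane_drawing ::
    "'a ugraph \<Rightarrow> ('a \<Rightarrow> complex) \<Rightarrow> ('a set \<Rightarrow> real \<Rightarrow> complex) \<Rightarrow> bool" where
  "plane_drawing G p \<gamma> \<longleftrightarrow>
     inj_on p (verts G) \<and>
     (\<forall>e\<in>edges G. arc (\<gamma> e) \<and> {pathstart (\<gamma> e), pathfinish (\<gamma> e)} = p ` e \<and>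
                   path_image (\<gamma> e) \<inter> p ` verts G = p ` e) \<and>
     (\<forall>e\<in>edges G. \<forall>e'\<in>edges G. e \<noteq> e' \<longrightarrow>
        path_image (\<gamma> e) \<inter> path_image (\<gamma> e') = p ` (e \<inter> e'))"

definition planar :: "'a ugraph \<Rightarrow> bool" where
  "planar G \<longleftrightarrow> (\<exists>p \<gamma>. plane_drawing G p \<gamma>)"


section \<open>The induced planar Turan number\<close>

text \<open>
  Every finite graph is isomorphic to one whose vertices are natural numbers, so it suffices to let
  the host graph range over graphs with vertices in \<^typ>\<open>nat\<close>.  By
  \<open>finite_ind_planar_sizes\<close> below, the maximum is a genuine one whenever some
  admissible host graph exists.
\<close>

definition ind_planar_sizes :: "nat \<Rightarrow> 'b ugraph \<Rightarrow> nat set" where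
  "ind_planar_sizes n F =
     {card (edges G) | G :: nat ugraph.
        simple_graph G \<and> card (verts G) = n \<and> planar G \<and> induced_free F G}"

definition ex_planar_ind :: "nat \<Rightarrow> 'b ugraph \<Rightarrow> nat" where
  "ex_planar_ind n F = Max (ind_planar_sizes n F)"

lemma finite_ind_planar_sizes: "finite (ind_planar_sizes n F)"
proof (rule finite_subset)
  show "ind_planar_sizes n F \<subseteq> {..2 ^ n}"
  proof
    fix m assume "m \<in> ind_planar_sizes n F"
    then obtain G :: "nat ugraph" where
      G: "simple_graph G" "card (verts G) = n" "m = card (edges G)"
      by (auto simp: ind_planar_sizes_def)
    have "edges G \<subseteq> Pow (verts G)" "finite (Pow (verts G))"
      using G(1) by (auto simp: simple_graph_def)
    then have "card (edges G) \<le> card (Pow (verts G))"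
      by (rule card_mono[rotated])
    also have "\<dots> = 2 ^ n"
      using G(1,2) by (simp add: simple_graph_def card_Pow)
    finally show "m \<in> {..2 ^ n}" using G(3) by simp
  qed
qed simp


section \<open>The forbidden graphs\<close>

text \<open>\<open>cycle_graph k\<close> is the cycle on \<open>k\<close> vertices only for \<open>k \<ge> 3\<close>.\<close>

definition cycle_graph :: "nat \<Rightarrow> nat ugraph" where
  "cycle_graph k = \<lparr>verts = {..<k}, edges = {{i, Suc i mod k} | i. i < k}\<rparr>"

text \<open>The centre is \<open>0\<close>; the leaves are \<open>1, \<dots>, k\<close>.\<close>

definition star_graph :: "nat \<Rightarrow> nat ugraph" where
  "star_graph k = \<lparr>verts = {..k}, edges = {{0, i} | i. i \<in> {1..k}}\<rparr>"

definition complete_graph :: "nat \<Rightarrow> nat ugraph" where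
  "complete_graph m = \<lparr>verts = {..<m}, edges = {{i, j} | i j. i < m \<and> j < m \<and> i \<noteq> j}\<rparr>"

definition disjoint_union :: "'a ugraph \<Rightarrow> 'b ugraph \<Rightarrow> ('a + 'b) ugraph" where
  "disjoint_union G H =
     \<lparr>verts = verts G <+> verts H,
      edges = (image Inl) ` edges G \<union> (image Inr) ` edges H\<rparr>"

lemma simple_cycle_graph: "3 \<le> k \<Longrightarrow> simple_graph (cycle_graph k)"
proof -
  assume k: "3 \<le> k"
  have "i \<noteq> Suc i mod k" if "i < k" for i
    using that k by (cases "Suc i = k") auto
  then show ?thesis
    using k by (auto simp: simple_graph_def cycle_graph_def card_2_iff)
qed

lemma simple_star_graph: "simple_graph (star_graph k)"
  by (auto simp: simple_graph_def star_graph_def)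

lemma simple_complete_graph: "simple_graph (complete_graph m)"
  by (auto simp: simple_graph_def complete_graph_def)

lemma simple_disjoint_union:
  "simple_graph G \<Longrightarrow> simple_graph H \<Longrightarrow> simple_graph (disjoint_union G H)"
  by (auto simp: simple_graph_def disjoint_union_def card_image)

end

theory Submission
  imports Defs
begin

text \<open>
  Upper bound: contracting an edge of a plane graph keeps a weak kind of drawing, in which edges are
  path-connected sets and only disjoint edges are required not to meet.  Such a drawing of $K_5$ is
  impossible: for disjoint edges $ab$ and $cd$ the total turning of $x - y$ around the boundary of
  $ab \times cd$ vanishes, and adding these relations over all 15 pairs of disjoint edges gives
  a parity contradiction.  By Mader's argument, in a minimal graph with $3n - 5$ edges every edge
  lies in at least three triangles; a vertex of degree at most 5 together with its neighbours
  then contains a $K_5$ minor.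

  Lower bound: the cube of the path is a triangulation without induced claws and without induced
  cycles of length at least 4; the double wheel is a triangulation whose triangles all pass through
  one of the two non-adjacent hubs, which excludes $K_4$ and $2K_3$.
\<close>

section \<open>Weak drawings and the bound on the number of edges\<close>

text \<open>The turning of \<open>g\<close> around \<open>z\<close>, kept as the full complex
  increment of log(g - z) so that its exponential is a ratio determined by the end points. The value
  is arbitrary if \<open>g - z\<close> has no continuous logarithm on the unit interval.\<close>

definition log_change :: "(real \<Rightarrow> complex) \<Rightarrow> complex \<Rightarrow> complex" where
  "log_change g z = (SOME d. \<exists>q. continuous_on {0..1} q \<and> (\<forall>t\<in>{0..1}. g t - z = exp (q t)) \<and> d = q 1 - q 0)"

text \<open>Two continuous logarithms of the same function differ by a continuous function into the
  discrete set 2 pi i Z, which is constant on an interval. Hence the choice made by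
  \<open>SOME\<close> does not affect the increment.\<close>

lemma log_change_eq:
  assumes q: "continuous_on {0..1} q" "\<And>t. t \<in> {0..1} \<Longrightarrow> g t - z = exp (q t)"
  shows "log_change g z = q 1 - q 0"
proof -
  have *: "q' 1 - q' 0 = q 1 - q 0"
    if q': "continuous_on {0..1} q'" "\<forall>t\<in>{0..1}. g t - z = exp (q' t)" for q'
  proof -
    have e: "exp (q' t - q t) = 1" if "t \<in> {0..1}" for t
      using q(2)[OF that] q'(2) that by (simp add: exp_diff)
    have "(\<lambda>t. q' t - q t) constant_on {0..1}"
    proof (rule continuous_discrete_range_constant)
      show "connected {0..1::real}" by simp
      show "continuous_on {0..1} (\<lambda>t. q' t - q t)"
        using q(1) q'(1) by (intro continuous_intros)
      fix x :: real assume x: "x \<in> {0..1}"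
      have "2 * pi \<le> cmod (q' y - q y - (q' x - q x))"
        if y: "y \<in> {0..1}" and ne: "q' y - q y \<noteq> q' x - q x" for y
      proof (rule ccontr)
        assume "\<not> ?thesis"
        then have "\<bar>Im (q' y - q y) - Im (q' x - q x)\<bar> < 2 * pi"
          using abs_Im_le_cmod[of "q' y - q y - (q' x - q x)"] by simp
        then have "q' y - q y = q' x - q x"
          using e[OF x] e[OF y] by (simp add: exp_complex_eqI)
        with ne show False by simp
      qed
      then show "\<exists>e>0. \<forall>y. y \<in> {0..1} \<and> q' y - q y \<noteq> q' x - q x
          \<longrightarrow> e \<le> cmod (q' y - q y - (q' x - q x))"
        using pi_gt_zero by (intro exI[of _ "2 * pi"]) auto
    qed
    then obtain c where "\<And>t. t \<in> {0..1} \<Longrightarrow> q' t - q t = c"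
      unfolding constant_on_def by blast
    from this[of 0] this[of 1] show ?thesis by (simp add: algebra_simps)
  qed
  show ?thesis
    unfolding log_change_def by (rule some_equality) (use q * in blast)+
qed

text \<open>A continuous logarithm exists because the interval is contractible. The end points thus
  fix the increment modulo 2 pi i; the remaining integer is what the parity argument counts.\<close>

lemma exp_log_change:
  assumes "path g" "z \<notin> path_image g"
  shows "exp (log_change g z) = (pathfinish g - z) / (pathstart g - z)"
proof -
  have nz: "g t - z \<noteq> 0" if "t \<in> {0..1}" for t
    using assms(2) that by (auto simp: path_image_def)
  obtain q where q: "continuous_on {0..1} q" "\<And>t. t \<in> {0..1} \<Longrightarrow> g t - z = exp (q t)"
  proof (rule continuous_logarithm_on_contractible)
    show "continuous_on {0..1} (\<lambda>t. g t - z)"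
      using assms(1) unfolding path_def by (intro continuous_intros)
    show "contractible {0..1::real}"
      by (intro convex_imp_contractible) simp
  qed (use nz in auto)
  have "exp (log_change g z) = exp (q 1) / exp (q 0)"
    using log_change_eq[of q g z, OF q] by (simp add: exp_diff)
  then show ?thesis
    using q(2)[of 0] q(2)[of 1] by (simp add: pathfinish_def pathstart_def)
qed

text \<open>A logarithm of $g(t) - h(s)$ on the unit square, read along its four sides.\<close>

lemma log_change_exchange:
  assumes "path g" "path h" "path_image g \<inter> path_image h = {}"
  shows "log_change g (pathfinish h) - log_change g (pathstart h) =
         log_change h (pathfinish g) - log_change h (pathstart g)"
proof -
  let ?S = "{0..1} \<times> {0..1} :: (real \<times> real) set"
  have "continuous_on ?S (\<lambda>x. g (fst x))"
    by (rule continuous_on_compose2[OF assms(1)[unfolded path_def]])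
      (auto intro: continuous_on_fst continuous_on_id)
  moreover have "continuous_on ?S (\<lambda>x. h (snd x))"
    by (rule continuous_on_compose2[OF assms(2)[unfolded path_def]])
      (auto intro: continuous_on_snd continuous_on_id)
  ultimately have "continuous_on ?S (\<lambda>x. g (fst x) - h (snd x))"
    by (rule continuous_on_diff)
  moreover have "g (fst x) - h (snd x) \<noteq> 0" if "x \<in> ?S" for x
    using assms(3) that by (force simp: path_image_def)
  moreover have "contractible ?S"
    by (intro convex_imp_contractible convex_Times) auto
  ultimately obtain L where L: "continuous_on ?S L"
      "\<And>x. x \<in> ?S \<Longrightarrow> g (fst x) - h (snd x) = exp (L x)"
    using continuous_logarithm_on_contractible[of ?S "\<lambda>x. g (fst x) - h (snd x)"] by auto
  have *: "log_change g (h s) = L (1, s) - L (0, s)" if "s \<in> {0..1}" for s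
    using that L(2)[of "(_, s)"]
    by (intro log_change_eq[where q = "\<lambda>t. L (t, s)"] continuous_on_compose2[OF L(1)]
          continuous_on_Pair continuous_on_const continuous_on_id) auto
  have **: "log_change h (g t) = L (t, 1) - L (t, 0)" if "t \<in> {0..1}" for t
  proof -
    \<comment> \<open>Adding pi i turns a logarithm of \<open>g t - h s\<close> into one of
      \<open>h s - g t\<close>; the shift cancels in the increment.\<close>
    have "log_change h (g t) = (L (t, 1) + \<i> * pi) - (L (t, 0) + \<i> * pi)"
    proof (intro log_change_eq[where q = "\<lambda>s. L (t, s) + \<i> * pi"])
      show "continuous_on {0..1} (\<lambda>s. L (t, s) + \<i> * pi)"
        using that
        by (intro continuous_on_add continuous_on_compose2[OF L(1)]
              continuous_on_Pair continuous_on_const continuous_on_id) auto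
      show "h s - g t = exp (L (t, s) + \<i> * pi)" if "s \<in> {0..1}" for s
      proof -
        have "h s - g t = - (g t - h s)" by simp
        also have "\<dots> = exp (L (t, s) + \<i> * pi)"
          using L(2)[of "(t, s)"] that \<open>t \<in> {0..1}\<close> by (simp add: exp_add)
        finally show ?thesis .
      qed
    qed
    then show ?thesis by simp
  qed
  show ?thesis
    using *[of 0] *[of 1] **[of 0] **[of 1]
    by (simp add: pathstart_def pathfinish_def)
qed

section \<open>The parity obstruction for K5\<close>

lemma K5_paths_intersect:
  fixes q :: "nat \<Rightarrow> complex" and g :: "nat \<Rightarrow> nat \<Rightarrow> real \<Rightarrow> complex"
  assumes path: "\<And>i j. i < j \<Longrightarrow> j < 5 \<Longrightarrow> path (g i j) \<and> pathstart (g i j) = q i \<and> pathfinish (g i j) = q j"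
    and avoid: "\<And>i j k. i < j \<Longrightarrow> j < 5 \<Longrightarrow> k < 5 \<Longrightarrow> k \<noteq> i \<Longrightarrow> k \<noteq> j \<Longrightarrow> q k \<notin> path_image (g i j)"
    and disj: "\<And>i j k l. i < j \<Longrightarrow> k < l \<Longrightarrow> j < 5 \<Longrightarrow> l < 5 \<Longrightarrow> {i, j} \<inter> {k, l} = {} \<Longrightarrow>
                 path_image (g i j) \<inter> path_image (g k l) = {}"
  shows False
proof -
  \<comment> \<open>\<open>A i j + \<i> * pi * inv i j\<close> is a logarithm of \<open>q i - q j\<close>, normalised so that swapping
    \<open>i\<close> and \<open>j\<close> changes it by exactly \<open>\<plusminus> \<i> * pi\<close>; the integers \<open>N\<close> below
    measure how far the edges wind away from these choices.\<close>
  define W where "W i j k = log_change (g i j) (q k)" for i j k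
  define A where "A i j = Ln (q (min i j) - q (max i j))" for i j
  define inv where "inv i j = (if i < j then 0 else 1 :: int)" for i j :: nat
  have A_sym: "A i j = A j i" for i j
    by (simp add: A_def min.commute max.commute)
  have "q i \<noteq> q j" if "i < j" "j < 5" for i j
  proof -
    \<comment> \<open>A third vertex: the edge between \<open>i\<close> and \<open>k\<close> runs
      through \<open>q i\<close> but has to avoid \<open>q j\<close>.\<close>
    define k where "k = (if i \<noteq> 0 then 0 else if j \<noteq> 1 then 1 else 2 :: nat)"
    have k: "k < 5" "k \<noteq> i" "k \<noteq> j"
      using that by (auto simp: k_def)
    define e where "e = g (min i k) (max i k)"
    have "q i \<in> path_image e"
      using path[of "min i k" "max i k"] k that pathstart_in_path_image[of e] pathfinish_in_path_image[of e]
      by (cases "i < k") (auto simp: e_def)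
    moreover have "q j \<notin> path_image e"
      using avoid[of "min i k" "max i k" j] k that by (cases "i < k") (auto simp: e_def)
    ultimately show ?thesis by metis
  qed
  then have neq: "q i \<noteq> q j" if "i \<noteq> j" "i < 5" "j < 5" for i j
    using that by (metis nat_neq_iff)
  have expA: "exp (A i j + \<i> * pi * inv i j) = q i - q j" if "i \<noteq> j" "i < 5" "j < 5" for i j
    using that neq[OF that] by (auto simp: A_def inv_def exp_add min_def max_def)
  have "\<exists>n::int. W i j k = (A j k + \<i> * pi * inv j k) - (A i k + \<i> * pi * inv i k) + 2 * \<i> * pi * n"
    if "i < j" "j < 5" "k < 5" "k \<noteq> i" "k \<noteq> j" for i j k
  proof -
    have "exp (W i j k) = (q j - q k) / (q i - q k)"
      unfolding W_def using exp_log_change avoid[OF that] path[OF that(1,2)] by metis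
    also have "\<dots> = exp ((A j k + \<i> * pi * inv j k) - (A i k + \<i> * pi * inv i k))"
      using that by (simp only: exp_diff expA)
    finally show ?thesis
      unfolding exp_eq by (auto simp: algebra_simps)
  qed
  then obtain N :: "nat \<Rightarrow> nat \<Rightarrow> nat \<Rightarrow> int" where N:
    "\<And>i j k. i < j \<Longrightarrow> j < 5 \<Longrightarrow> k < 5 \<Longrightarrow> k \<noteq> i \<Longrightarrow> k \<noteq> j \<Longrightarrow>
       W i j k = (A j k + \<i> * pi * inv j k) - (A i k + \<i> * pi * inv i k) + 2 * \<i> * pi * N i j k"
    by metis
  \<comment> \<open>In the exchange relation the symmetric \<open>A\<close> terms cancel. Each
    inversion occurs twice, once from either side, because \<open>inv b a = 1 - inv a b\<close>;
    this turns multiples of pi i into multiples of 2 pi i.\<close>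
  have eq: "N i j l - N i j k - N k l j + N k l i = inv i l - inv j l + inv j k - inv i k"
    if ij: "i < j" "j < 5" and kl: "k < l" "l < 5" and d: "i \<noteq> k" "i \<noteq> l" "j \<noteq> k" "j \<noteq> l" for i j k l
  proof -
    have inv: "inv b a = 1 - inv a b" if "a \<noteq> b" for a b
      using that by (auto simp: inv_def)
    have "W i j l - W i j k = W k l j - W k l i"
      unfolding W_def using log_change_exchange[of "g i j" "g k l"] path[OF ij] path[OF kl]
        disj[OF ij(1) kl(1) ij(2) kl(2)] d by simp
    then have "2 * \<i> * pi * (of_int (N i j l - N i j k - N k l j + N k l i - (inv i l - inv j l + inv j k - inv i k))) = 0"
      using ij kl d
      by (simp add: N A_sym[of l] A_sym[of k] inv[of i l] inv[of j l] inv[of i k] inv[of j k] algebra_simps)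
    then have "(of_int (N i j l - N i j k - N k l j + N k l i - (inv i l - inv j l + inv j k - inv i k)) :: complex) = 0"
      by (metis mult_eq_0_iff complex_i_not_zero of_real_eq_0_iff pi_neq_zero zero_neq_numeral)
    then show ?thesis unfolding of_int_eq_0_iff by simp
  qed
  \<comment> \<open>One line for each 4-subset of the five vertices, with its three splittings into
    two pairs.\<close>
  note e = eq[of 0 1 2 3] eq[of 0 2 1 3] eq[of 0 3 1 2]
    eq[of 0 1 2 4] eq[of 0 2 1 4] eq[of 0 4 1 2]
    eq[of 0 1 3 4] eq[of 0 3 1 4] eq[of 0 4 1 3]
    eq[of 0 2 3 4] eq[of 0 3 2 4] eq[of 0 4 2 3]
    eq[of 1 2 3 4] eq[of 1 3 2 4] eq[of 1 4 2 3]
  \<comment> \<open>Every \<open>N i j k\<close> occurs in exactly two of the 15 equations, while the right-hand sides add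
    up to the number of crossings of $K_5$ drawn with its vertices in convex position.\<close>
  have "2 * (- N 0 1 2 + N 2 3 0 - N 0 2 1 - N 1 3 2 +
      N 1 3 0 - N 0 3 1 - N 1 2 3 + N 1 2 0 + N 0 1 4 + N 2 4 0 + N 0 2 4 -
      N 1 4 2 + N 1 4 0 -
      N 0 4 1 + N 3 4 0 + N 0 3 4 + N 0 4 3 - N 3 4 2 - N 2 4 3 - N 2 3 4) = 5"
    using e by (simp add: inv_def)
  then show False by presburger
qed

section \<open>Weak drawings and contraction\<close>

text \<open>Edges sharing a vertex may meet anywhere; this is what makes the notion stable under contraction.\<close>

definition weak_drawing :: "'a set \<Rightarrow> 'a set set \<Rightarrow> ('a \<Rightarrow> complex) \<Rightarrow> ('a set \<Rightarrow> complex set) \<Rightarrow> bool" where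
  "weak_drawing V E p K \<longleftrightarrow>
     (\<forall>e\<in>E. path_connected (K e) \<and> p ` e \<subseteq> K e \<and> (\<forall>v\<in>V - e. p v \<notin> K e)) \<and>
     (\<forall>e\<in>E. \<forall>f\<in>E. e \<inter> f = {} \<longrightarrow> K e \<inter> K f = {})"

lemma weak_drawing_mono:
  "weak_drawing V E p K \<Longrightarrow> V' \<subseteq> V \<Longrightarrow> E' \<subseteq> E \<Longrightarrow> weak_drawing V' E' p K"
  by (simp add: weak_drawing_def subset_iff)

lemma plane_drawing_imp_weak_drawing:
  assumes "simple_graph G" "plane_drawing G p \<gamma>"
  shows "weak_drawing (verts G) (edges G) p (path_image \<circ> \<gamma>)"
proof -
  have inj: "inj_on p (verts G)" and sub: "\<And>e. e \<in> edges G \<Longrightarrow> e \<subseteq> verts G"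
    using assms by (auto simp: plane_drawing_def simple_graph_def)
  have arc: "arc (\<gamma> e)" "path_image (\<gamma> e) \<inter> p ` verts G = p ` e" if "e \<in> edges G" for e
    using assms(2) that by (auto simp: plane_drawing_def)
  have int: "path_image (\<gamma> e) \<inter> path_image (\<gamma> f) = p ` (e \<inter> f)"
    if "e \<in> edges G" "f \<in> edges G" "e \<noteq> f" for e f
    using assms(2) that by (auto simp: plane_drawing_def)
  have "p v \<notin> path_image (\<gamma> e)" if "e \<in> edges G" "v \<in> verts G - e" for e v
  proof
    assume "p v \<in> path_image (\<gamma> e)"
    then have "p v \<in> p ` e"
      using arc(2) that by blast
    then show False
      using inj sub that by (meson DiffD1 DiffD2 inj_on_image_mem_iff)
  qed
  moreover have "path_image (\<gamma> e) \<inter> path_image (\<gamma> f) = {}"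
    if "e \<in> edges G" "f \<in> edges G" "e \<inter> f = {}" for e f
  proof -
    have "e \<noteq> f"
      using that assms(1) by (force simp: simple_graph_def)
    then show ?thesis
      using int that by simp
  qed
  ultimately show ?thesis
    using arc by (fastforce simp: weak_drawing_def intro: path_connected_path_image arc_imp_path)
qed

text \<open>The merged vertex keeps the name \<open>u\<close>. Parallel edges coincide because edges
  are sets, and \<open>w \<noteq> u\<close> drops the loop.\<close>

definition contract :: "'a \<Rightarrow> 'a \<Rightarrow> 'a set set \<Rightarrow> 'a set set" where
  "contract u v E = {e \<in> E. v \<notin> e} \<union> {{u, w} |w. {v, w} \<in> E \<and> w \<noteq> u}"

text \<open>An edge \<open>{v, w}\<close> that becomes a new edge \<open>{u, w}\<close> is drawn as
  the union of \<open>K {u, v}\<close> and \<open>K {v, w}\<close>, which is connected through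
  \<open>p v\<close>. Any two such edges share \<open>u\<close>, so no disjointness is demanded of
  them.\<close>

lemma weak_drawing_contract:
  assumes wd: "weak_drawing V E p K" and uv: "{u, v} \<in> E" "u \<noteq> v"
    and E: "\<And>e. e \<in> E \<Longrightarrow> e \<subseteq> V \<and> card e = 2"
  shows "\<exists>K'. weak_drawing (V - {v}) (contract u v E) p K'"
proof
  \<comment> \<open>If \<open>e\<close> is new, \<open>insert v (e - {u})\<close> is the edge at
    \<open>v\<close> from which it comes.\<close>
  let ?K = "\<lambda>e. if e \<in> E then K e else K {u, v} \<union> K (insert v (e - {u}))"
  let ?P = "\<lambda>e. v \<notin> e \<and> (e \<in> E \<or> (u \<in> e \<and> insert v (e - {u}) \<in> E))"
  have contr: "?P e" if "e \<in> contract u v E" for e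
  proof -
    have "insert v ({u, w} - {u}) = {v, w}" if "w \<noteq> u" for w
      using that by auto
    moreover have "v \<noteq> w" if "{v, w} \<in> E" for w
      using E[OF that] by auto
    ultimately show ?thesis
      using that uv by (auto simp: contract_def)
  qed
  have K: "path_connected (K e)" "p ` e \<subseteq> K e" "\<And>v. v \<in> V \<Longrightarrow> v \<notin> e \<Longrightarrow> p v \<notin> K e" if "e \<in> E" for e
    using wd that by (auto simp: weak_drawing_def)
  have dis: "K e \<inter> K f = {}" if "e \<in> E" "f \<in> E" "e \<inter> f = {}" for e f
    using wd that by (auto simp: weak_drawing_def)
  have vertex: "path_connected (?K e) \<and> p ` e \<subseteq> ?K e \<and> (\<forall>x\<in>(V - {v}) - e. p x \<notin> ?K e)" if "?P e" for e
  proof (cases "e \<in> E")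
    case True
    then show ?thesis using K by auto
  next
    case False
    then have e: "u \<in> e" "insert v (e - {u}) \<in> E" using that by auto
    have "p v \<in> K {u, v} \<inter> K (insert v (e - {u}))"
      using K(2)[OF uv(1)] K(2)[OF e(2)] by auto
    then have "path_connected (?K e)"
      using False K(1) uv e by (auto intro!: path_connected_Un)
    moreover have "p ` e \<subseteq> ?K e"
      using False K(2)[OF uv(1)] K(2)[OF e(2)] by auto
    moreover have "p x \<notin> ?K e" if "x \<in> (V - {v}) - e" for x
      using False K(3)[OF uv(1), of x] K(3)[OF e(2), of x] that e by auto
    ultimately show ?thesis by blast
  qed
  have disjoint: "?K e \<inter> ?K f = {}" if "?P e" "?P f" "e \<inter> f = {}" for e f
  proof -
    have *: "?K e \<inter> ?K f = {}" if "?P e" "?P f" "e \<inter> f = {}" "f \<in> E" for e f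
    proof (cases "e \<in> E")
      case False
      then have e: "u \<in> e" "insert v (e - {u}) \<in> E" using that by auto
      have "K {u, v} \<inter> K f = {}" "K (insert v (e - {u})) \<inter> K f = {}"
        using dis[OF uv(1) that(4)] dis[OF e(2) that(4)] that(1-3) e by auto
      then show ?thesis using False that by auto
    qed (use that dis in auto)
    show ?thesis
    proof (cases "e \<in> E \<or> f \<in> E")
      case True
      then show ?thesis using *[of e f] *[of f e] that by (metis Int_commute)
    next
      case False
      then have "u \<in> e" "u \<in> f" using that by auto
      then show ?thesis using that(3) by blast
    qed
  qed
  show "weak_drawing (V - {v}) (contract u v E) p ?K"
    unfolding weak_drawing_def
    by (intro conjI ballI impI disjoint[OF contr contr]) (use vertex[OF contr] in blast)+
qed

lemma weak_drawing_no_K5: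
  assumes wd: "weak_drawing V E p K" and S: "S \<subseteq> V" "card S = 5"
    and clique: "\<And>x y. x \<in> S \<Longrightarrow> y \<in> S \<Longrightarrow> x \<noteq> y \<Longrightarrow> {x, y} \<in> E"
  shows False
proof -
  obtain h where h: "bij_betw h {0..<5::nat} S"
    using ex_bij_betw_nat_finite[of S] S(2) by (metis card.infinite zero_neq_numeral)
  have hS: "h i \<in> S" if "i < 5" for i
    using h that by (auto simp: bij_betw_def)
  have hne: "h i \<noteq> h j" if "i \<noteq> j" "i < 5" "j < 5" for i j
    using h that by (auto simp: bij_betw_def inj_on_def)
  have edge: "{h i, h j} \<in> E" if "i < j" "j < 5" for i j
    using clique hS hne that by auto
  have "\<exists>g. path g \<and> path_image g \<subseteq> K {h i, h j} \<and> pathstart g = p (h i) \<and> pathfinish g = p (h j)"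
    if "i < j" "j < 5" for i j
  proof -
    have "path_connected (K {h i, h j})" "p ` {h i, h j} \<subseteq> K {h i, h j}"
      using wd edge[OF that] by (auto simp: weak_drawing_def)
    then show ?thesis
      unfolding path_connected_def by auto
  qed
  then obtain g where g: "\<And>i j. i < j \<Longrightarrow> j < 5 \<Longrightarrow> path (g i j) \<and> path_image (g i j) \<subseteq> K {h i, h j} \<and>
      pathstart (g i j) = p (h i) \<and> pathfinish (g i j) = p (h j)"
    by metis
  show False
  proof (rule K5_paths_intersect[of g "p \<circ> h"])
    fix i j k :: nat assume ij: "i < j" "j < 5" and k: "k < 5" "k \<noteq> i" "k \<noteq> j"
    have "h k \<in> V - {h i, h j}"
      using hS S(1) hne ij k by auto
    then have "p (h k) \<notin> K {h i, h j}"
      using wd edge[OF ij] by (auto simp: weak_drawing_def)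
    then show "(p \<circ> h) k \<notin> path_image (g i j)"
      using g[OF ij] by auto
  next
    fix i j k l :: nat
    assume ij: "i < j" "j < 5" and kl: "k < l" "l < 5" and d: "{i, j} \<inter> {k, l} = {}"
    have "{h i, h j} \<inter> {h k, h l} = {}"
      using ij kl d hne by auto
    then have "K {h i, h j} \<inter> K {h k, h l} = {}"
      using wd edge[OF ij] edge[OF kl] by (auto simp: weak_drawing_def)
    then show "path_image (g i j) \<inter> path_image (g k l) = {}"
      using g[OF ij] g[OF kl] by blast
  qed (use g in auto)
qed

section \<open>Counting edges at a vertex and under contraction\<close>

definition nbrs :: "'a set set \<Rightarrow> 'a \<Rightarrow> 'a set" where
  "nbrs E x = {y. {x, y} \<in> E}"

lemma nbrs_commute: "y \<in> nbrs E x \<longleftrightarrow> x \<in> nbrs E y"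
  by (simp add: nbrs_def insert_commute)

lemma nbrs_irrefl:
  assumes "\<And>e. e \<in> E \<Longrightarrow> card e = 2"
  shows "x \<notin> nbrs E x"
  using assms[of "{x}"] by (auto simp: nbrs_def)

lemma incident_edges_eq:
  assumes "\<And>e. e \<in> E \<Longrightarrow> card e = 2"
  shows "{e \<in> E. v \<in> e} = (\<lambda>w. {v, w}) ` nbrs E v"
proof -
  have "\<exists>w. e = {v, w}" if "e \<in> E" "v \<in> e" for e
    using assms[OF that(1)] that(2) by (auto simp: card_2_iff)
  then show ?thesis
    by (auto simp: nbrs_def)
qed

lemma card_incident_edges:
  assumes "\<And>e. e \<in> E \<Longrightarrow> card e = 2"
  shows "card {e \<in> E. v \<in> e} = card (nbrs E v)"
proof -
  have "{e \<in> E. v \<in> e} = (\<lambda>w. {v, w}) ` nbrs E v"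
    using assms by (rule incident_edges_eq)
  moreover have "inj_on (\<lambda>w. {v, w}) (nbrs E v)"
    by (auto simp: inj_on_def doubleton_eq_iff)
  ultimately show ?thesis
    by (simp add: card_image)
qed

lemma sum_card_nbrs:
  assumes "finite V" "finite E" and E: "\<And>e. e \<in> E \<Longrightarrow> e \<subseteq> V \<and> card e = 2"
  shows "(\<Sum>v\<in>V. card (nbrs E v)) = 2 * card E"
proof -
  have "card {v \<in> V. v \<in> e} = 2" if "e \<in> E" for e
    using E[OF that] by (metis Collect_conj_eq Collect_mem_eq inf.absorb_iff2)
  then have "(\<Sum>v\<in>V. card {e \<in> E. v \<in> e}) = (\<Sum>e\<in>E. 2)"
    using assms(1,2) by (intro sum_multicount_gen) auto
  then show ?thesis
    using E by (simp add: card_incident_edges)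
qed

text \<open>Contraction loses the edge \<open>{u, v}\<close> itself and one edge of each pair that
  merges, that is, one for each common neighbour.\<close>

lemma card_contract:
  assumes fin: "finite V" and E: "\<And>e. e \<in> E \<Longrightarrow> e \<subseteq> V \<and> card e = 2" and uv: "{u, v} \<in> E"
  shows "card (contract u v E) + 1 + card (nbrs E u \<inter> nbrs E v) = card E"
proof -
  have finE: "finite E"
    using E fin by (meson Pow_iff finite_Pow_iff finite_subset subsetI)
  have sub: "nbrs E x \<subseteq> V" for x
    using E by (auto simp: nbrs_def)
  then have finN: "finite (nbrs E x)" for x
    using fin finite_subset by blast
  \<comment> \<open>\<open>?D\<close> consists of the neighbours of \<open>v\<close> whose edge
    becomes a genuinely new edge at \<open>u\<close>.\<close>
  let ?A = "{e \<in> E. v \<notin> e}" and ?D = "nbrs E v - {u} - nbrs E u"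
  have inj: "inj_on (\<lambda>w. {u, w}) X" for X
    by (auto simp: inj_on_def doubleton_eq_iff)
  have irr: "x \<notin> nbrs E x" for x
    using nbrs_irrefl E by metis
  have "contract u v E = ?A \<union> (\<lambda>w. {u, w}) ` ?D"
    using irr[of v] irr[of u] uv by (auto simp: contract_def nbrs_def)
  moreover have "?A \<inter> (\<lambda>w. {u, w}) ` ?D = {}"
    by (auto simp: nbrs_def)
  ultimately have c: "card (contract u v E) = card ?A + card ?D"
    using finE finN by (simp add: card_Un_disjoint card_image[OF inj])
  have "card E = card (?A \<union> {e \<in> E. v \<in> e})"
    by (rule arg_cong[where f = card]) auto
  also have "\<dots> = card ?A + card (nbrs E v)"
    using finE E by (subst card_Un_disjoint) (auto simp: card_incident_edges)
  also have "card (nbrs E v) = card (insert u ((nbrs E u \<inter> nbrs E v) \<union> ?D))"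
    using uv by (intro arg_cong[where f = card]) (auto simp: nbrs_def insert_commute)
  also have "\<dots> = 1 + card ((nbrs E u \<inter> nbrs E v) \<union> ?D)"
    using finN irr[of u] by simp
  also have "card ((nbrs E u \<inter> nbrs E v) \<union> ?D) = card (nbrs E u \<inter> nbrs E v) + card ?D"
    using finN by (intro card_Un_disjoint) auto
  finally show ?thesis
    using c by simp
qed

lemma contract_edges:
  assumes E: "\<And>e. e \<in> E \<Longrightarrow> e \<subseteq> V \<and> card e = 2" and uv: "{u, v} \<in> E" and e: "e \<in> contract u v E"
  shows "e \<subseteq> V - {v} \<and> card e = 2"
proof -
  have "v \<noteq> w \<and> w \<in> V \<and> u \<in> V" if "{v, w} \<in> E" for w
    using E[OF that] E[OF uv] by auto
  moreover have "u \<noteq> v"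
    using E[OF uv] by auto
  ultimately show ?thesis
    using e E by (auto simp: contract_def)
qed

section \<open>The bound 3n - 6 by Mader's argument\<close>

text \<open>The listed edges form an octahedron with poles \<open>v\<close>, \<open>x\<close>,
  together with the edge between the poles; its equator is the 4-cycle \<open>a\<close>,
  \<open>c\<close>, \<open>b\<close>, \<open>d\<close>. Contracting \<open>{a, c}\<close> makes
  \<open>a\<close> adjacent to \<open>b\<close>, so \<open>v\<close>, \<open>x\<close>,
  \<open>a\<close>, \<open>b\<close>, \<open>d\<close> become a K5.\<close>

lemma weak_drawing_no_octahedron_plus:
  assumes wd: "weak_drawing V E p K" and E: "\<And>e. e \<in> E \<Longrightarrow> e \<subseteq> V \<and> card e = 2"
    and dist: "distinct [v, x, a, b, c, d]" and V: "{v, x, a, b, c, d} \<subseteq> V"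
    and edges: "{v, x} \<in> E" "{v, a} \<in> E" "{v, b} \<in> E" "{v, c} \<in> E" "{v, d} \<in> E"
      "{x, a} \<in> E" "{x, b} \<in> E" "{x, c} \<in> E" "{x, d} \<in> E"
      "{a, c} \<in> E" "{a, d} \<in> E" "{b, c} \<in> E" "{b, d} \<in> E"
  shows False
proof -
  obtain K' where K': "weak_drawing (V - {c}) (contract a c E) p K'"
    using weak_drawing_contract[OF wd edges(10) _ E] dist by auto
  have ab: "{a, b} \<in> contract a c E"
    using edges(12) dist unfolding contract_def by (auto simp: insert_commute)
  have keep: "{y, z} \<in> contract a c E \<and> {z, y} \<in> contract a c E"
    if "{y, z} \<in> E" "y \<noteq> c" "z \<noteq> c" for y z
    using that unfolding contract_def by (auto simp: insert_commute)
  show False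
  proof (rule weak_drawing_no_K5[OF K'])
    show "{v, x, a, b, d} \<subseteq> V - {c}" "card {v, x, a, b, d} = 5"
      using dist V by auto
    have dc: "d \<noteq> c"
      using dist by auto
    have *: "{v, x} \<in> contract a c E \<and> {x, v} \<in> contract a c E"
      "{v, a} \<in> contract a c E \<and> {a, v} \<in> contract a c E"
      "{v, b} \<in> contract a c E \<and> {b, v} \<in> contract a c E"
      "{v, d} \<in> contract a c E \<and> {d, v} \<in> contract a c E"
      "{x, a} \<in> contract a c E \<and> {a, x} \<in> contract a c E"
      "{x, b} \<in> contract a c E \<and> {b, x} \<in> contract a c E"
      "{x, d} \<in> contract a c E \<and> {d, x} \<in> contract a c E"
      "{a, d} \<in> contract a c E \<and> {d, a} \<in> contract a c E"
      "{b, d} \<in> contract a c E \<and> {d, b} \<in> contract a c E"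
      "{a, b} \<in> contract a c E \<and> {b, a} \<in> contract a c E"
      using keep[OF edges(1)] keep[OF edges(2)] keep[OF edges(3)] keep[OF edges(5)] keep[OF edges(6)] keep[OF edges(7)]
        keep[OF edges(9)] keep[OF edges(11)] keep[OF edges(13)] dist dc ab
      by (simp_all add: insert_commute[of b a])
    show "{y, z} \<in> contract a c E" if "y \<in> {v, x, a, b, d}" "z \<in> {v, x, a, b, d}" "y \<noteq> z" for y z
      using that(1,2)
      by (elim insertE emptyE; hypsubst) (use that(3) * in simp_all)
  qed
qed

lemma card_edges_le_choose:
  assumes "finite V" and "\<And>e. e \<in> E \<Longrightarrow> e \<subseteq> V \<and> card e = 2"
  shows "card E \<le> card V choose 2"
proof -
  have "card E \<le> card {B. B \<subseteq> V \<and> card B = 2}"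
    using assms by (intro card_mono) auto
  then show ?thesis
    using n_subsets[OF assms(1)] by simp
qed

theorem weak_drawing_edge_bound:
  assumes "finite V" "3 \<le> card V" "weak_drawing V E p K"
    and "\<And>e. e \<in> E \<Longrightarrow> e \<subseteq> V \<and> card e = 2"
  shows "card E + 6 \<le> 3 * card V"
  using assms
proof (induction "card V" arbitrary: V E K rule: less_induct)
  case less
  show ?case
  proof (rule ccontr)
    assume many: "\<not> ?thesis"
    \<comment> \<open>On 3 or 4 vertices even the complete graph has only 3n - 6 edges.\<close>
    have "card V \<noteq> 3" "card V \<noteq> 4"
      using many card_edges_le_choose[OF less.prems(1,4)] by (auto simp: choose_two)
    with less.prems(2) have V5: "5 \<le> card V"
      by simp
    \<comment> \<open>Fixing exactly 3n - 5 edges serves both sides: the lower bound drives the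
      contraction step, the upper bound yields a vertex of small degree.\<close>
    obtain E0 where E0: "E0 \<subseteq> E" "card E0 = 3 * card V - 5"
      by (rule obtain_subset_with_card_n[of "3 * card V - 5" E]) (use many in auto)
    have E: "e \<subseteq> V \<and> card e = 2" if "e \<in> E0" for e
      using less.prems(4) E0(1) that by auto
    have finE: "finite E0"
      using E less.prems(1) by (meson Pow_iff finite_Pow_iff finite_subset subsetI)
    have wd: "weak_drawing V E0 p K"
      using weak_drawing_mono[OF less.prems(3)] E0(1) by blast
    let ?N = "nbrs E0"
    have NV: "?N x \<subseteq> V" for x
      using E by (auto simp: nbrs_def)
    have finN: "finite (?N x)" for x
      using NV less.prems(1) finite_subset by blast
    have irr: "x \<notin> ?N x" for x
      using nbrs_irrefl E by metis
    \<comment> \<open>By induction the contraction has at most 3(n - 1) - 6 = 3n - 9 edges, so at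
      least four of the 3n - 5 are lost: the contracted edge and three for common
      neighbours.\<close>
    have common: "3 \<le> card (?N v \<inter> ?N w)" if vw: "w \<in> ?N v" for v w
    proof -
      have e: "{v, w} \<in> E0"
        using vw by (simp add: nbrs_def)
      have w: "w \<in> V" "v \<noteq> w"
        using E[OF e] by auto
      obtain K' where K': "weak_drawing (V - {w}) (contract v w E0) p K'"
        using weak_drawing_contract[OF wd e w(2)] E by blast
      have "e' \<subseteq> V - {w} \<and> card e' = 2" if "e' \<in> contract v w E0" for e'
        using E e that by (rule contract_edges)
      then have "card (contract v w E0) + 6 \<le> 3 * card (V - {w})"
        using less.prems(1) w V5 by (intro less.hyps[OF _ _ _ K']) auto
      moreover have "card (contract v w E0) + 1 + card (?N v \<inter> ?N w) = card E0"
        using less.prems(1) E e by (rule card_contract)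
      ultimately show ?thesis
        using w V5 less.prems(1) E0(2) by simp
    qed
    \<comment> \<open>Otherwise the degree sum would be at least 6n, whereas it is 6n - 10.\<close>
    have "\<exists>v\<in>V. card (?N v) \<le> 5"
    proof (rule ccontr)
      assume "\<not> ?thesis"
      then have "(\<Sum>v\<in>V. 6) \<le> (\<Sum>v\<in>V. card (?N v))"
        by (intro sum_mono) auto
      then show False
        using sum_card_nbrs[OF less.prems(1) finE] E E0(2) V5 by simp
    qed
    then obtain v where v: "v \<in> V" "card (?N v) \<le> 5" by blast
    let ?D = "?N v"
    \<comment> \<open>Without neighbours, \<open>v\<close> could be deleted and all 3n - 5 edges
      would remain on n - 1 vertices, against the induction hypothesis.\<close>
    have "?D \<noteq> {}"
    proof
      assume "?D = {}"
      then have "v \<notin> e" if "e \<in> E0" for e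
        using incident_edges_eq[of E0 v] E that by auto
      then have "e \<subseteq> V - {v} \<and> card e = 2" if "e \<in> E0" for e
        using E that by blast
      then have "card E0 + 6 \<le> 3 * card (V - {v})"
        using less.prems(1) v V5
        by (intro less.hyps[OF _ _ _ weak_drawing_mono[OF wd]]) auto
      then show False
        using v V5 less.prems(1) E0(2) by simp
    qed
    then obtain w0 where w0: "w0 \<in> ?D" by blast
    have D_nb: "3 \<le> card (?D \<inter> ?N w)" "?D \<inter> ?N w \<subseteq> ?D - {w}" if "w \<in> ?D" for w
      using common[OF that] irr[of w] by auto
    have "card (?D \<inter> ?N w0) \<le> card (?D - {w0})"
      using D_nb(2)[OF w0] finN by (intro card_mono) auto
    then have D4: "4 \<le> card ?D"
      using D_nb(1)[OF w0] w0 finN by simp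
    have edge: "{x, y} \<in> E0 \<longleftrightarrow> y \<in> ?N x" for x y
      by (simp add: nbrs_def)
    have no_K4: False if S: "S \<subseteq> ?D" "card S = 4"
      and cl: "\<And>x y. x \<in> S \<Longrightarrow> y \<in> S \<Longrightarrow> x \<noteq> y \<Longrightarrow> y \<in> ?N x" for S
    proof (rule weak_drawing_no_K5[OF wd])
      show "insert v S \<subseteq> V"
        using v S NV[of v] by auto
      have "finite S" "v \<notin> S"
        using S finN finite_subset irr[of v] by blast+
      then show "card (insert v S) = 5"
        using S by simp
      show "{x, y} \<in> E0" if "x \<in> insert v S" "y \<in> insert v S" "x \<noteq> y" for x y
        using that cl S(1) nbrs_commute[of _ E0] unfolding edge by auto
    qed
    show False
    proof (cases "card ?D = 4")
      case True
      \<comment> \<open>Three neighbours among the other three: \<open>?D\<close> is a clique and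
        forms a K5 with \<open>v\<close>.\<close>
      have "y \<in> ?N x" if "x \<in> ?D" "y \<in> ?D" "x \<noteq> y" for x y
      proof -
        have "?D \<inter> ?N x = ?D - {x}"
          using D_nb[OF that(1)] True that(1) finN by (intro card_seteq) auto
        then show ?thesis using that by blast
      qed
      then show False using no_K4[of ?D] True by blast
    next
      case False
      then have D5: "card ?D = 5"
        using D4 v by simp
      \<comment> \<open>At least three of the other four vertices of \<open>?D\<close> are adjacent
        to \<open>w\<close>, so at most one is not: the missing pairs in \<open>?D\<close> form a
        matching.\<close>
      have uniq: "y = z" if "w \<in> ?D" "y \<in> ?D" "z \<in> ?D" "y \<notin> ?N w" "z \<notin> ?N w" "y \<noteq> w" "z \<noteq> w" for w y z
      proof (rule ccontr)
        assume "y \<noteq> z"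
        then have "card {w, y, z} = 3" "{w, y, z} \<subseteq> ?D"
          using that by auto
        then have "card (?D - {w, y, z}) = 2"
          using D5 by (simp add: card_Diff_subset)
        moreover have "card (?D \<inter> ?N w) \<le> card (?D - {w, y, z})"
          using that irr[of w] finN by (intro card_mono) auto
        ultimately show False
          using D_nb(1)[OF that(1)] by simp
      qed
      have sub4: "\<exists>S. S \<subseteq> ?D \<and> card S = 4"
        using obtain_subset_with_card_n[OF D4] by metis
      then obtain a b where ab: "a \<in> ?D" "b \<in> ?D" "a \<noteq> b" "b \<notin> ?N a"
        using no_K4 by (meson subsetD)
      have "card (?D - {a, b}) = 3"
        using ab D5 by (simp add: card_Diff_subset)
      then obtain c d x where cdx: "?D - {a, b} = {c, d, x}" "c \<noteq> d" "c \<noteq> x" "d \<noteq> x"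
        by (auto simp: card_3_iff)
      then have D: "?D = {a, b, c, d, x}"
        using ab by auto
      have ne: "a \<notin> {c, d, x}" "b \<notin> {c, d, x}"
        using cdx(1) by auto
      have abN: "y \<in> ?N a" "y \<in> ?N b" if "y \<in> {c, d, x}" for y
        using uniq[of a b y] uniq[of b a y] ab that ne D nbrs_commute[of a E0 b] by auto
      \<comment> \<open>If a second pair \<open>y\<close>, \<open>z\<close> is missing, the fifth
        vertex \<open>t\<close> is adjacent to the other four, so \<open>v\<close> and
        \<open>t\<close> are the poles of an octahedron with equator \<open>a\<close>,
        \<open>y\<close>, \<open>b\<close>, \<open>z\<close>.\<close>
      have octa: False if yz: "{y, z, t} = {c, d, x}" "distinct [y, z, t]" "z \<notin> ?N y" for y z t
      proof -
        have D': "?D = {a, b, y, z, t}" and ne': "a \<notin> {y, z, t}" "b \<notin> {y, z, t}"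
          using D yz ne by auto
        have ab': "w \<in> ?N a" "w \<in> ?N b" if "w \<in> {y, z, t}" for w
          using abN that yz(1) by auto
        have t: "t \<in> ?N y" "t \<in> ?N z"
          using uniq[of y z t] uniq[of z y t] yz(2,3) D' nbrs_commute[of y E0 z] by auto
        have "v \<notin> ?D" using irr .
        then have "distinct [v, t, a, b, y, z]"
          using yz(2) ne' ab(3) unfolding D' by auto
        moreover have "{v, t, a, b, y, z} \<subseteq> V"
          using v(1) NV[of v] unfolding D' by auto
        moreover have "t \<in> ?N v" "a \<in> ?N v" "b \<in> ?N v" "y \<in> ?N v" "z \<in> ?N v"
          unfolding D' by auto
        moreover have "a \<in> ?N t" "b \<in> ?N t" "y \<in> ?N t" "z \<in> ?N t"
          using t ab'[of t] nbrs_commute[of t E0] by auto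
        moreover have "y \<in> ?N a" "z \<in> ?N a" "y \<in> ?N b" "z \<in> ?N b"
          using ab' by auto
        ultimately show False
          using weak_drawing_no_octahedron_plus[OF wd, of v t a b y z] E unfolding edge by blast
      qed
      \<comment> \<open>With \<open>a\<close>, \<open>b\<close> as the only missing pair, dropping
        \<open>b\<close> leaves four pairwise adjacent neighbours of \<open>v\<close>.\<close>
      show False
      proof (rule no_K4[of "{a, c, d, x}"])
        show "q \<in> ?N p" if "p \<in> {a, c, d, x}" "q \<in> {a, c, d, x}" "p \<noteq> q" for p q
        proof -
          have "d \<in> ?N c"
            by (rule ccontr, rule octa[of c d x]) (use cdx in auto)
          moreover have "x \<in> ?N c"
            by (rule ccontr, rule octa[of c x d]) (use cdx in auto)
          moreover have "x \<in> ?N d"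
            by (rule ccontr, rule octa[of d x c]) (use cdx in auto)
          ultimately have "d \<in> ?N c" "x \<in> ?N c" "x \<in> ?N d" "c \<in> ?N d" "c \<in> ?N x" "d \<in> ?N x"
            using nbrs_commute[of _ E0] by auto
          moreover have "c \<in> ?N a" "d \<in> ?N a" "x \<in> ?N a" "a \<in> ?N c" "a \<in> ?N d" "a \<in> ?N x"
            using abN(1) nbrs_commute[of a E0] by auto
          ultimately show ?thesis
            using that by auto
        qed
      qed (use D cdx ne in auto)
    qed
  qed
qed

corollary planar_edge_bound:
  assumes "simple_graph G" "planar G" "3 \<le> card (verts G)"
  shows "card (edges G) + 6 \<le> 3 * card (verts G)"
proof -
  obtain p \<gamma> where "plane_drawing G p \<gamma>"
    using assms(2) by (auto simp: planar_def)
  from plane_drawing_imp_weak_drawing[OF assms(1) this] show ?thesis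
    using assms(1,3) by (intro weak_drawing_edge_bound) (auto simp: simple_graph_def)
qed

section \<open>Two extremal triangulations\<close>

definition ordered_graph :: "nat \<Rightarrow> (nat \<Rightarrow> nat \<Rightarrow> bool) \<Rightarrow> nat ugraph" where
  "ordered_graph n R = \<lparr>verts = {..<n}, edges = {{i, j} |i j. i < j \<and> j < n \<and> R i j}\<rparr>"

lemma verts_ordered_graph [simp]: "verts (ordered_graph n R) = {..<n}"
  by (simp add: ordered_graph_def)

lemma ordered_graph_edge_iff:
  "{i, j} \<in> edges (ordered_graph n R) \<longleftrightarrow> i < n \<and> j < n \<and> (i < j \<and> R i j \<or> j < i \<and> R j i)"
  by (auto simp: ordered_graph_def doubleton_eq_iff)

lemma ordered_graph_edgeE:
  assumes "e \<in> edges (ordered_graph n R)"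
  obtains i j where "e = {i, j}" "i < j" "j < n" "R i j"
  using assms by (auto simp: ordered_graph_def)

lemma simple_ordered_graph: "simple_graph (ordered_graph n R)"
  by (auto simp: simple_graph_def ordered_graph_def)

lemma card_edges_ordered_graph:
  "card (edges (ordered_graph n R)) = card {(i, j). i < j \<and> j < n \<and> R i j}"
proof -
  have "edges (ordered_graph n R) = (\<lambda>(i, j). {i, j}) ` {(i, j). i < j \<and> j < n \<and> R i j}"
    by (auto simp: ordered_graph_def)
  moreover have "inj_on (\<lambda>(i, j). {i, j}) {(i, j). i < j \<and> j < n \<and> R i j}"
    by (auto simp: inj_on_def doubleton_eq_iff)
  ultimately show ?thesis
    by (simp add: card_image)
qed

text \<open>
  Along each edge $ij$ with $i < j$, some linear functional separates $p_i$ from all later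
  points and attains its maximum over those at $p_j$; so the segment meets the convex hull of the
  later points in $p_j$ only.
\<close>

lemma planar_ordered_graph:
  fixes p :: "nat \<Rightarrow> complex"
  assumes sep: "\<And>i j. i < j \<Longrightarrow> j < n \<Longrightarrow> R i j \<Longrightarrow>
      \<exists>w. w \<bullet> p j < w \<bullet> p i \<and> (\<forall>k. i < k \<and> k < n \<longrightarrow> w \<bullet> p k \<le> w \<bullet> p j)"
    and succ: "\<And>i. Suc i < n \<Longrightarrow> \<exists>j. i < j \<and> j < n \<and> R i j"
  shows "planar (ordered_graph n R)"
proof -
  let ?seg = "\<lambda>i j. closed_segment (p i) (p j)"
  have seg_le: "w \<bullet> x \<le> c" if "x \<in> closed_segment a b" "w \<bullet> a \<le> c" "w \<bullet> b \<le> c" for w x a b :: complex and c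
    using that convex_halfspace_le[of w c] closed_segment_subset[of a "{x. w \<bullet> x \<le> c}" b] by auto
  have later: "x = p j" if ij: "i < j" "j < n" "R i j" and x: "x \<in> ?seg i j"
    and kl: "i < k" "k < n" "i < l" "l < n" "x \<in> ?seg k l" for i j k l x
  proof -
    obtain w where w: "w \<bullet> p j < w \<bullet> p i" "\<forall>k. i < k \<and> k < n \<longrightarrow> w \<bullet> p k \<le> w \<bullet> p j"
      using sep[OF ij] by blast
    obtain t where t: "0 \<le> t" "t \<le> 1" "x = (1 - t) *\<^sub>R p i + t *\<^sub>R p j"
      using x by (auto simp: in_segment)
    have "w \<bullet> x \<le> w \<bullet> p j"
      using w(2) kl by (intro seg_le[OF kl(5)]) auto
    then have "(1 - t) * (w \<bullet> p i - w \<bullet> p j) \<le> 0"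
      by (simp add: t(3) inner_add_right algebra_simps)
    then have "t = 1"
      using w(1) t(2) by (simp add: mult_le_0_iff)
    then show ?thesis using t by simp
  qed
  \<comment> \<open>\<open>succ\<close> provides an edge leaving \<open>i\<close>, and its
    functional puts \<open>p i\<close> strictly outside the hull of the later points.\<close>
  have apex: "p i \<notin> ?seg k l" if "i < k" "k < n" "i < l" "l < n" for i k l
  proof
    assume i: "p i \<in> ?seg k l"
    have "Suc i < n"
      using that by simp
    then obtain j where j: "i < j" "j < n" "R i j"
      using succ by blast
    obtain w where w: "w \<bullet> p j < w \<bullet> p i" "\<forall>k. i < k \<and> k < n \<longrightarrow> w \<bullet> p k \<le> w \<bullet> p j"
      using sep[OF j] by blast
    have "w \<bullet> p i \<le> w \<bullet> p j"
      using w(2) that by (intro seg_le[OF i]) auto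
    with w(1) show False by simp
  qed
  have ne: "p i \<noteq> p j" if "i \<noteq> j" "i < n" "j < n" for i j
    using apex[of i j j] apex[of j i i] that by (cases "i < j") auto
  have vertex: "m = i \<or> m = j" if ij: "i < j" "j < n" "R i j" and m: "m < n" "p m \<in> ?seg i j" for i j m
  proof -
    consider "m < i" | "m = i" | "i < m" by linarith
    then show ?thesis
    proof cases
      case 1
      then show ?thesis using apex[of m i j] ij m by auto
    next
      case 3
      then have "p m = p j"
        using later[OF ij m(2), of m m] m(1) by simp
      then show ?thesis using ne[of m j] m ij by auto
    qed simp
  qed
  \<comment> \<open>Two edges leaving \<open>i\<close> can meet elsewhere only by pointing in the
    same direction; then the nearer end point lies on the longer segment, against
    \<open>vertex\<close>.\<close>
  have fan: "x = p i" if ij: "i < j" "j < n" "R i j" and il: "i < l" "l < n" "R i l" and "j \<noteq> l"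
    and x: "x \<in> ?seg i j" "x \<in> ?seg i l" for i j l x
  proof (rule ccontr)
    assume xi: "x \<noteq> p i"
    obtain s where s: "0 \<le> s" "s \<le> 1" "x = (1 - s) *\<^sub>R p i + s *\<^sub>R p j"
      using x(1) by (auto simp: in_segment)
    obtain t where t: "0 \<le> t" "t \<le> 1" "x = (1 - t) *\<^sub>R p i + t *\<^sub>R p l"
      using x(2) by (auto simp: in_segment)
    have pos: "0 < s" "0 < t"
      using xi s t by (auto simp: less_le)
    have eq: "s *\<^sub>R (p j - p i) = t *\<^sub>R (p l - p i)"
      using s(3) t(3) by (simp add: algebra_simps)
    have *: "b \<in> closed_segment (p i) a"
      if "0 < s" "s \<le> t" "s *\<^sub>R (a - p i) = t *\<^sub>R (b - p i)" for s t a b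
    proof -
      have "(s / t) *\<^sub>R (a - p i) = (1 / t) *\<^sub>R (s *\<^sub>R (a - p i))"
        by simp
      also have "\<dots> = b - p i"
        using that by simp
      finally have "b = (1 - s / t) *\<^sub>R p i + (s / t) *\<^sub>R a"
        by (simp add: algebra_simps)
      moreover have "0 \<le> s / t" "s / t \<le> 1"
        using that by auto
      ultimately show ?thesis
        by (auto simp: in_segment)
    qed
    show False
    proof (cases "s \<le> t")
      case True
      then have "p l \<in> ?seg i j"
        using *[of s t "p j" "p l"] pos eq by auto
      then show False
        using vertex[OF ij il(2)] \<open>j \<noteq> l\<close> il(1) by auto
    next
      case False
      then have "p j \<in> ?seg i l"
        using *[of t s "p l" "p j"] pos eq by auto
      then show False
        using vertex[OF il ij(2)] \<open>j \<noteq> l\<close> ij(1) by auto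
    qed
  qed
  have edges_meet: "x \<in> p ` ({i, j} \<inter> {k, l})"
    if ij: "i < j" "j < n" "R i j" and kl: "k < l" "l < n" "R k l" and "{i, j} \<noteq> {k, l}" "i \<le> k"
    and x: "x \<in> ?seg i j" "x \<in> ?seg k l" for i j k l x
  proof (cases "i = k")
    case True
    then show ?thesis
      using fan[of i j l x] that by auto
  next
    case False
    then have "x = p j"
      using later[OF ij x(1), of k l] kl x(2) \<open>i \<le> k\<close> by auto
    moreover have "j = k \<or> j = l"
      using vertex[OF kl ij(2)] x(2) \<open>x = p j\<close> by blast
    ultimately show ?thesis by auto
  qed
  define \<gamma> where "\<gamma> e = linepath (p (Min e)) (p (Max e))" for e
  have \<gamma>: "\<gamma> {i, j} = linepath (p i) (p j)" if "i < j" for i j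
    using that by (simp add: \<gamma>_def)
  have "plane_drawing (ordered_graph n R) p \<gamma>"
    unfolding plane_drawing_def
  proof (intro conjI ballI impI)
    show "inj_on p (verts (ordered_graph n R))"
      using ne by (auto simp: inj_on_def)
  next
    fix e assume "e \<in> edges (ordered_graph n R)"
    then obtain i j where e: "e = {i, j}" "i < j" "j < n" "R i j"
      by (rule ordered_graph_edgeE)
    show "arc (\<gamma> e)"
      using ne[of i j] e by (simp add: \<gamma> arc_linepath)
    show "{pathstart (\<gamma> e), pathfinish (\<gamma> e)} = p ` e"
      using e by (simp add: \<gamma>)
    show "path_image (\<gamma> e) \<inter> p ` verts (ordered_graph n R) = p ` e"
      using e vertex[OF e(2-4)] by (auto simp: \<gamma>)
  next
    fix e f assume "e \<in> edges (ordered_graph n R)" "f \<in> edges (ordered_graph n R)" and ef: "e \<noteq> f"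
    then obtain i j k l where e: "e = {i, j}" "i < j" "j < n" "R i j"
      and f: "f = {k, l}" "k < l" "l < n" "R k l"
      by (elim ordered_graph_edgeE)
    have "x \<in> p ` (e \<inter> f)" if "x \<in> ?seg i j" "x \<in> ?seg k l" for x
      using edges_meet[OF e(2-4) f(2-4) _ _ that] edges_meet[OF f(2-4) e(2-4) _ _ that(2,1)] ef e(1) f(1)
      by (cases "i \<le> k") (simp_all add: Int_commute)
    moreover have "p m \<in> ?seg i j" if "m \<in> e" for m
      using that e(1) by auto
    moreover have "p m \<in> ?seg k l" if "m \<in> f" for m
      using that f(1) by auto
    ultimately show "path_image (\<gamma> e) \<inter> path_image (\<gamma> f) = p ` (e \<inter> f)"
      using e(1,2) f(1,2) by (auto simp: \<gamma>)
  qed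
  then show ?thesis
    unfolding planar_def by blast
qed

text \<open>Inverting the isomorphism turns an induced copy into an embedding \<open>g\<close> of
  the concrete graph \<open>F\<close>, whose vertices can then be named.\<close>

lemma induced_freeI:
  assumes "\<And>g. inj_on g (verts F) \<Longrightarrow> g ` verts F \<subseteq> verts G \<Longrightarrow>
    (\<And>u v. u \<in> verts F \<Longrightarrow> v \<in> verts F \<Longrightarrow> {g u, g v} \<in> edges G \<longleftrightarrow> {u, v} \<in> edges F) \<Longrightarrow> False"
  shows "induced_free F G"
  unfolding induced_free_def
proof
  assume "\<exists>S\<subseteq>verts G. graph_iso (induced G S) F"
  then obtain S f where S: "S \<subseteq> verts G" and f: "bij_betw f S (verts F)"
    and iso: "\<And>u v. u \<in> S \<Longrightarrow> v \<in> S \<Longrightarrow> {u, v} \<in> edges G \<longleftrightarrow> {f u, f v} \<in> edges F"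
    by (auto simp: graph_iso_def induced_def)
  let ?g = "inv_into S f"
  have g: "bij_betw ?g (verts F) S"
    using f by (rule bij_betw_inv_into)
  show False
  proof (rule assms)
    show "inj_on ?g (verts F)" "?g ` verts F \<subseteq> verts G"
      using g S by (auto simp: bij_betw_def)
    fix u v assume uv: "u \<in> verts F" "v \<in> verts F"
    then have "?g u \<in> S" "?g v \<in> S" "f (?g u) = u" "f (?g v) = v"
      using g f by (auto simp: bij_betw_def intro: f_inv_into_f)
    then show "{?g u, ?g v} \<in> edges G \<longleftrightarrow> {u, v} \<in> edges F"
      using iso[of "?g u" "?g v"] by simp
  qed
qed

section \<open>The cube of the path\<close>

definition path_cube :: "nat \<Rightarrow> nat ugraph" where
  "path_cube n = ordered_graph n (\<lambda>i j. j \<le> i + 3)"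

lemma path_cube_edge_iff:
  "{i, j} \<in> edges (path_cube n) \<longleftrightarrow> i < n \<and> j < n \<and> i \<noteq> j \<and> i \<le> j + 3 \<and> j \<le> i + 3"
  unfolding path_cube_def ordered_graph_edge_iff by auto

lemma card_edges_path_cube:
  assumes "3 \<le> n"
  shows "card (edges (path_cube n)) = 3 * n - 6"
proof -
  have "{(i, j). i < j \<and> j < n \<and> j \<le> i + 3} =
      (\<lambda>i. (i, i + 1)) ` {..<n - 1} \<union> (\<lambda>i. (i, i + 2)) ` {..<n - 2} \<union> (\<lambda>i. (i, i + 3)) ` {..<n - 3}"
    (is "_ = ?A \<union> ?B \<union> ?C")
    by (auto simp: image_iff)
  moreover have "card (?A \<union> ?B \<union> ?C) = card ?A + card ?B + card ?C"
    by (subst card_Un_disjoint, (auto)[3])+ simp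
  moreover have "card ?A = n - 1" "card ?B = n - 2" "card ?C = n - 3"
    by (simp_all add: card_image inj_on_def)
  ultimately have "card (edges (path_cube n)) = (n - 1) + (n - 2) + (n - 3)"
    by (simp only: path_cube_def card_edges_ordered_graph)
  then show ?thesis
    using assms by linarith
qed

text \<open>
  The points $z^i$ with $z = (-1 + i)/3$ spiral inwards: $z^{k+3}$ lies inside the triangle
  spanned by $z^k$, $z^{k+1}$, $z^{k+2}$.
\<close>

lemma planar_path_cube: "planar (path_cube n)"
proof -
  define z where "z = Complex (- 1 / 3) (1 / 3)"
  have z1: "Re z = - 1 / 3" "Im z = 1 / 3"
    by (simp_all add: z_def)
  have z2: "z ^ 2 = Complex 0 (- 2 / 9)" and z3: "z ^ 3 = Complex (2 / 27) (2 / 27)"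
    by (simp_all add: power2_eq_square power3_eq_cube complex_eq_iff z1)
  \<comment> \<open>The coefficients are positive with sum 1: they are the barycentric coordinates
    of \<open>z ^ 3\<close> in the triangle 1, \<open>z\<close>, \<open>z ^ 2\<close>.\<close>
  have rec: "z ^ (k + 3) = (2 / 9) *\<^sub>R z ^ k + (4 / 9) *\<^sub>R z ^ (k + 1) + (1 / 3) *\<^sub>R z ^ (k + 2)" for k
  proof -
    have "z ^ 3 = (2 / 9) *\<^sub>R 1 + (4 / 9) *\<^sub>R z + (1 / 3) *\<^sub>R z ^ 2"
      by (simp add: z1 z2 z3 complex_eq_iff)
    then have "z ^ k * z ^ 3 = z ^ k * ((2 / 9) *\<^sub>R 1 + (4 / 9) *\<^sub>R z + (1 / 3) *\<^sub>R z ^ 2)"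
      by simp
    then show ?thesis
      by (simp add: power_add algebra_simps power2_eq_square power3_eq_cube)
  qed
  \<comment> \<open>By \<open>rec\<close> every later power is a convex combination of earlier ones,
    so a bound has to be tested on the first three only.\<close>
  have hull: "w \<bullet> z ^ k \<le> c"
    if "1 \<le> k" "w \<bullet> z \<le> c" "w \<bullet> z ^ 2 \<le> c" "w \<bullet> z ^ 3 \<le> c" for w c k
    using that(1)
  proof (induction k rule: less_induct)
    case (less k)
    show ?case
    proof (cases "k \<le> 3")
      case True
      then consider "k = 1" | "k = 2" | "k = 3" using less.prems by linarith
      then show ?thesis using that by cases auto
    next
      case False
      then have "w \<bullet> z ^ k = w \<bullet> z ^ ((k - 3) + 3)"
        by simp
      also have "\<dots> = 2 / 9 * (w \<bullet> z ^ (k - 3)) + 4 / 9 * (w \<bullet> z ^ (k - 3 + 1)) + 1 / 3 * (w \<bullet> z ^ (k - 3 + 2))"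
        unfolding rec by (simp add: inner_add_right)
      finally have "w \<bullet> z ^ k = 2 / 9 * (w \<bullet> z ^ (k - 3)) + 4 / 9 * (w \<bullet> z ^ (k - 3 + 1)) + 1 / 3 * (w \<bullet> z ^ (k - 3 + 2))" .
      moreover have "w \<bullet> z ^ (k - 3) \<le> c" "w \<bullet> z ^ (k - 3 + 1) \<le> c" "w \<bullet> z ^ (k - 3 + 2) \<le> c"
        using False by (intro less.IH; simp)+
      ultimately show ?thesis by linarith
    qed
  qed
  have sep: "\<exists>w. w \<bullet> z ^ d < w \<bullet> 1 \<and> (\<forall>k\<ge>1. w \<bullet> z ^ k \<le> w \<bullet> z ^ d)" if "1 \<le> d" "d \<le> 3" for d
  proof -
    have *: ?thesis if "w \<bullet> z ^ d < w \<bullet> 1" "w \<bullet> z \<le> w \<bullet> z ^ d" "w \<bullet> z ^ 2 \<le> w \<bullet> z ^ d"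
      "w \<bullet> z ^ 3 \<le> w \<bullet> z ^ d" for w
      using that hull by blast
    consider "d = 1" | "d = 2" | "d = 3" using \<open>1 \<le> d\<close> \<open>d \<le> 3\<close> by linarith
    then show ?thesis
    proof cases
      case 1
      then show ?thesis
        by (intro *[of "Complex 3 5"]) (simp_all add: z1 z2 z3 inner_complex_def)
    next
      case 2
      then show ?thesis
        by (intro *[of "Complex 1 (-1)"]) (simp_all add: z1 z2 z3 inner_complex_def)
    next
      case 3
      then show ?thesis
        by (intro *[of "Complex 1 0"]) (simp_all add: z1 z2 z3 inner_complex_def)
    qed
  qed
  \<comment> \<open>Multiplication by \<open>z ^ i\<close> is a similarity: it scales inner products
    by a positive factor and carries a functional found at 1 to one at \<open>z ^ i\<close>.\<close>
  have inner_mult: "(a * c) \<bullet> (b * c) = (cmod c)\<^sup>2 * (a \<bullet> b)" for a b c :: complex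
    unfolding inner_complex_def cmod_power2 by (simp add: power2_eq_square algebra_simps)
  show ?thesis
    unfolding path_cube_def
  proof (rule planar_ordered_graph[where p = "\<lambda>i. z ^ i"])
    fix i j assume ij: "i < j" "j < n" "j \<le> i + 3"
    have "1 \<le> j - i" "j - i \<le> 3"
      using ij by linarith+
    then obtain w where w: "w \<bullet> z ^ (j - i) < w \<bullet> 1" "\<forall>k\<ge>1. w \<bullet> z ^ k \<le> w \<bullet> z ^ (j - i)"
      using sep by blast
    have "z \<noteq> 0"
      using z1 by auto
    then have pos: "0 < (cmod (z ^ i))\<^sup>2"
      by simp
    have *: "(w * z ^ i) \<bullet> z ^ k = (cmod (z ^ i))\<^sup>2 * (w \<bullet> z ^ (k - i))" if "i \<le> k" for k
      using inner_mult[of w "z ^ i" "z ^ (k - i)"] that by (simp flip: power_add)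
    show "\<exists>w. w \<bullet> z ^ j < w \<bullet> z ^ i \<and> (\<forall>k. i < k \<and> k < n \<longrightarrow> w \<bullet> z ^ k \<le> w \<bullet> z ^ j)"
    proof (intro exI conjI allI impI)
      show "(w * z ^ i) \<bullet> z ^ j < (w * z ^ i) \<bullet> z ^ i"
        using *[of j] *[of i] w(1) ij pos by simp
      show "(w * z ^ i) \<bullet> z ^ k \<le> (w * z ^ i) \<bullet> z ^ j" if "i < k \<and> k < n" for k
      proof -
        have "w \<bullet> z ^ (k - i) \<le> w \<bullet> z ^ (j - i)"
          using w(2)[rule_format, of "k - i"] that by linarith
        then show ?thesis
          using *[of j] *[of k] ij that by (simp add: mult_left_mono)
      qed
    qed
  next
    show "\<exists>j. i < j \<and> j < n \<and> j \<le> i + 3" if "Suc i < n" for i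
      using that by (intro exI[of _ "Suc i"]) auto
  qed
qed

text \<open>The cycle vertex with the smallest position has both its cycle neighbours among the next
  three positions. These positions are pairwise adjacent, so the two neighbours are joined, which is
  a chord because \<open>k\<close> is at least 4.\<close>

lemma path_cube_cycle_free:
  assumes "4 \<le> k"
  shows "induced_free (cycle_graph k) (path_cube n)"
proof (rule induced_freeI)
  fix g assume inj: "inj_on g (verts (cycle_graph k))"
    and adj: "\<And>u v. u \<in> verts (cycle_graph k) \<Longrightarrow> v \<in> verts (cycle_graph k) \<Longrightarrow>
      {g u, g v} \<in> edges (path_cube n) \<longleftrightarrow> {u, v} \<in> edges (cycle_graph k)"
  have edge: "{u, v} \<in> edges (cycle_graph k) \<longleftrightarrow>
      v = u + 1 \<or> u = v + 1 \<or> u = 0 \<and> v = k - 1 \<or> v = 0 \<and> u = k - 1" if "u < k" "v < k" for u v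
  proof -
    have "{u, v} \<in> edges (cycle_graph k) \<longleftrightarrow> v = Suc u mod k \<or> u = Suc v mod k"
      using that by (auto simp: cycle_graph_def doubleton_eq_iff)
    moreover have "Suc w mod k = (if w = k - 1 then 0 else Suc w)" if "w < k" for w
      using that by auto
    ultimately show ?thesis
      using that assms by auto
  qed
  have adj': "{g u, g v} \<in> edges (path_cube n) \<longleftrightarrow> {u, v} \<in> edges (cycle_graph k)" if "u < k" "v < k" for u v
    using adj that by (simp add: cycle_graph_def)
  obtain i where i: "i < k" "\<And>j. j < k \<Longrightarrow> g i \<le> g j"
    using arg_min_nat_lemma[of "\<lambda>i. i < k" 0 g] assms by auto
  define s where "s = (if i = k - 1 then 0 else i + 1)"
  define r where "r = (if i = 0 then k - 1 else i - 1)"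
  have sr: "s < k" "r < k" "s \<noteq> r"
    using i(1) assms by (auto simp: s_def r_def split: if_splits)
  have "{g i, g s} \<in> edges (path_cube n)" "{g i, g r} \<in> edges (path_cube n)"
    using i(1) assms sr by (auto simp: adj' edge s_def r_def)
  moreover have "g s \<noteq> g r"
    using inj sr by (auto simp: inj_on_def cycle_graph_def)
  ultimately have "{g s, g r} \<in> edges (path_cube n)"
    using i(2)[OF sr(1)] i(2)[OF sr(2)] unfolding path_cube_edge_iff by auto
  then show False
    using i(1) assms sr by (auto simp: adj' edge s_def r_def split: if_splits)
qed

text \<open>Two of the three leaves lie on the same side of the centre, both within distance 3 of
  it, and are therefore adjacent.\<close>

lemma path_cube_claw_free: "induced_free (star_graph 3) (path_cube n)"
proof (rule induced_freeI)
  fix g assume inj: "inj_on g (verts (star_graph 3))"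
    and adj: "\<And>u v. u \<in> verts (star_graph 3) \<Longrightarrow> v \<in> verts (star_graph 3) \<Longrightarrow>
      {g u, g v} \<in> edges (path_cube n) \<longleftrightarrow> {u, v} \<in> edges (star_graph 3)"
  have centre: "{g 0, g i} \<in> edges (path_cube n)" if "i \<in> {1, 2, 3}" for i
  proof -
    have i: "i \<in> {1..3}" using that by auto
    then have "{0, i} \<in> edges (star_graph 3)"
      unfolding star_graph_def ugraph.simps by blast
    then show ?thesis
      using adj[of 0 i] i by (simp add: star_graph_def)
  qed
  have leaves: "{g i, g j} \<notin> edges (path_cube n) \<and> g i \<noteq> g j" if "i \<in> {1, 2, 3}" "j \<in> {1, 2, 3}" "i \<noteq> j" for i j
  proof -
    have ij: "i \<in> {..3}" "j \<in> {..3}" "i \<noteq> 0" "j \<noteq> 0"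
      using that by auto
    then have "{i, j} \<notin> edges (star_graph 3)"
      by (auto simp: star_graph_def doubleton_eq_iff)
    moreover have "g i \<noteq> g j"
      using inj_onD[OF inj, of i j] ij that(3) by (auto simp: star_graph_def)
    ultimately show ?thesis
      using adj[of i j] ij by (simp add: star_graph_def)
  qed
  show False
    using centre[of 1] centre[of 2] centre[of 3] leaves[of 1 2] leaves[of 1 3] leaves[of 2 3]
    unfolding path_cube_edge_iff by simp linarith
qed

section \<open>The double wheel\<close>

text \<open>The hubs are \<open>0\<close> and \<open>n - 1\<close>; the rim is the cycle $1, \dots, n-2$.\<close>

definition double_wheel :: "nat \<Rightarrow> nat ugraph" where
  "double_wheel n = ordered_graph n (\<lambda>i j.
     i = 0 \<and> j < n - 1 \<or> 0 < i \<and> j = n - 1 \<or> 0 < i \<and> j = i + 1 \<and> j < n - 1 \<or> i = 1 \<and> j = n - 2)"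

lemma card_edges_double_wheel:
  assumes "6 \<le> n"
  shows "card (edges (double_wheel n)) = 3 * n - 6"
proof -
  have "{(i, j). i < j \<and> j < n \<and>
      (i = 0 \<and> j < n - 1 \<or> 0 < i \<and> j = n - 1 \<or> 0 < i \<and> j = i + 1 \<and> j < n - 1 \<or> i = 1 \<and> j = n - 2)} =
      (\<lambda>j. (0, j)) ` {1..<n - 1} \<union> (\<lambda>i. (i, n - 1)) ` {1..<n - 1} \<union>
      (\<lambda>i. (i, i + 1)) ` {1..<n - 2} \<union> {(1, n - 2)}"
    (is "_ = ?A \<union> ?B \<union> ?C \<union> ?D")
    using assms by (auto simp: image_iff)
  moreover have "card (?A \<union> ?B \<union> ?C \<union> ?D) = card ?A + card ?B + card ?C + card ?D"
    using assms by (subst card_Un_disjoint, (auto)[3])+ simp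
  moreover have "card ?A = n - 2" "card ?B = n - 2" "card ?C = n - 3" "card ?D = 1"
    by (simp_all add: card_image inj_on_def)
  ultimately have "card (edges (double_wheel n)) = (n - 2) + (n - 2) + (n - 3) + 1"
    by (simp only: double_wheel_def card_edges_ordered_graph)
  then show ?thesis
    using assms by linarith
qed

lemma planar_double_wheel:
  assumes n: "6 \<le> n"
  shows "planar (double_wheel n)"
proof -
  \<comment> \<open>The hub \<open>n - 1\<close> lies at the origin and the rim, apart from vertex 1, on the parabola
    $y = m^2 - x^2$; the hub 0 lies above all relevant tangents of the parabola.\<close>
  define m where "m = real n - 2"
  define q where "q k = real k - 1" for k
  define p where "p k = (if k = 0 then Complex (- 1) (2 * m\<^sup>2) else if k = 1 then Complex (- 1 / 3) (- 1)
    else if k = n - 1 then 0 else Complex (q k) (m\<^sup>2 - (q k)\<^sup>2))" for k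
  have m: "4 \<le> m"
    using n by (simp add: m_def)
  have p0: "p 0 = Complex (- 1) (2 * m\<^sup>2)" and p1: "p (Suc 0) = Complex (- 1 / 3) (- 1)" and hub: "p (n - 1) = 0"
    using n by (auto simp: p_def)
  have rim: "p k = Complex (q k) (m\<^sup>2 - (q k)\<^sup>2)" if "2 \<le> k" "k < n - 1" for k
    using that by (auto simp: p_def)
  have q: "1 \<le> q k" "q k \<le> m - 1" if "2 \<le> k" "k < n - 1" for k
    using that by (auto simp: q_def m_def)
  have q_mono: "q i < q j" if "i < j" for i j
    using that by (simp add: q_def)
  have all: "\<forall>k. i < k \<and> k < n \<longrightarrow> w \<bullet> p k \<le> c"
    if "0 \<le> c" "i = 0 \<Longrightarrow> w \<bullet> p (Suc 0) \<le> c" "\<And>k. 2 \<le> k \<Longrightarrow> i < k \<Longrightarrow> k < n - 1 \<Longrightarrow> w \<bullet> p k \<le> c" for i w c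
  proof (intro allI impI)
    fix k assume k: "i < k \<and> k < n"
    then consider "k = n - 1" | "k = 1" "i = 0" | "2 \<le> k" "k < n - 1" by linarith
    then show "w \<bullet> p k \<le> c"
      using that hub k by cases auto
  qed
  \<comment> \<open>For \<open>j\<close> on the parabola this is \<open>p j\<close> turned by a
    right angle, so the functional vanishes on the line through the hub \<open>n - 1\<close> and
    \<open>p j\<close>. By \<open>spoke_rim\<close> and \<open>pos\<close> its sign at a parabola
    vertex \<open>k\<close> is that of \<open>q j - q k\<close>.\<close>
  define spoke where "spoke j = Complex (- (m\<^sup>2 - (q j)\<^sup>2)) (q j)" for j
  have spoke_rim: "spoke j \<bullet> p k = (q j - q k) * (m\<^sup>2 + q j * q k)" if "2 \<le> k" "k < n - 1" for j k
    using rim[OF that] by (simp add: spoke_def inner_complex_def algebra_simps power2_eq_square)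
  \<comment> \<open>Vertex 1 is placed so that this is positive for \<open>j = 2\<close> and
    negative for \<open>j = n - 2\<close>, as the two rim edges at vertex 1 require.\<close>
  have spoke_1: "spoke j \<bullet> p (Suc 0) = (m\<^sup>2 - (q j)\<^sup>2) / 3 - q j" for j
    by (simp add: p1 spoke_def inner_complex_def field_simps)
  have pos: "0 < m\<^sup>2 + q j * q k" if "2 \<le> k" "k < n - 1" "2 \<le> j" "j < n - 1" for j k
    using m q[OF that(1,2)] q[OF that(3,4)] by (intro add_pos_nonneg) auto
  have behind: "spoke j \<bullet> p k \<le> 0" if "2 \<le> j" "j \<le> k" "k < n - 1" for j k
    using pos[of k j] q_mono[of j k] that by (cases "j = k") (auto simp: spoke_rim mult_le_0_iff)
  have front: "0 < spoke j \<bullet> p k" if "2 \<le> k" "k < j" "j < n - 1" for j k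
    using pos[of k j] q_mono[of k j] that by (auto simp: spoke_rim)
  show ?thesis
    unfolding double_wheel_def
  proof (rule planar_ordered_graph[where p = p])
    fix i j assume ij: "i < j" "j < n"
      and R: "i = 0 \<and> j < n - 1 \<or> 0 < i \<and> j = n - 1 \<or> 0 < i \<and> j = i + 1 \<and> j < n - 1 \<or> i = 1 \<and> j = n - 2"
    let ?sep = "\<lambda>w. w \<bullet> p j < w \<bullet> p i \<and> (\<forall>k. i < k \<and> k < n \<longrightarrow> w \<bullet> p k \<le> w \<bullet> p j)"
    consider (apex_1) "i = 0" "j = 1" | (apex) "i = 0" "2 \<le> j" "j < n - 1"
      | (hub_1) "i = 1" "j = n - 1" | (last) "i = n - 2" "j = n - 1"
      | (hub) "2 \<le> i" "i + 1 < n - 1" "j = n - 1" | (rim) "2 \<le> i" "j = i + 1" "j < n - 1"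
      | (rim_1) "i = 1" "j = 2" | (close) "i = 1" "j = n - 2"
    proof -
      consider "i = 0" "j = 1" | "i = 0" "2 \<le> j" "j < n - 1" | "0 < i" "j = n - 1"
        | "0 < i" "j = i + 1" "j < n - 1" | "i = 1" "j = n - 2"
        using R ij(1) by (metis One_nat_def Suc_leI less_2_cases_iff not_less gr_implies_not0)
      then show thesis
      proof cases
        case 3
        then consider "i = 1" | "i = n - 2" | "2 \<le> i" "i + 1 < n - 1"
          using ij by linarith
        then show thesis using 3 that by cases blast+
      next
        case 4
        then consider "i = 1" "j = 2" | "2 \<le> i" by linarith
        then show thesis using 4 that by cases blast+
      qed (use that in blast)+
    qed
    then show "\<exists>w. ?sep w"
    proof cases
      case apex_1
      have "?sep (Complex (- 1) 0)"
        using apex_1 q by (intro conjI all) (force simp: p0 p1 rim inner_complex_def)+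
      then show ?thesis by blast
    next
      case apex
      \<comment> \<open>The functional is the normal of the parabola at \<open>p j\<close>, so among
        the parabola points it is largest there.\<close>
      have tangent: "Complex (2 * q j) 1 \<bullet> p k = m\<^sup>2 + (q j)\<^sup>2 - (q j - q k)\<^sup>2" if "2 \<le> k" "k < n - 1" for k
        using rim[OF that] by (simp add: inner_complex_def algebra_simps power2_eq_square)
      \<comment> \<open>This inequality puts hub 0 strictly above the tangent at
        \<open>p j\<close>.\<close>
      have "(q j + 1)\<^sup>2 \<le> m\<^sup>2"
        using q[OF apex(2,3)] by (intro power_mono) auto
      then have "(q j)\<^sup>2 + 2 * q j + 1 \<le> m\<^sup>2"
        by (simp add: power2_sum)
      moreover have "Complex (2 * q j) 1 \<bullet> p j = m\<^sup>2 + (q j)\<^sup>2"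
        using tangent[OF apex(2,3)] by simp
      moreover have "Complex (2 * q j) 1 \<bullet> p 0 = 2 * m\<^sup>2 - 2 * q j"
        "Complex (2 * q j) 1 \<bullet> p (Suc 0) = - 2 / 3 * q j - 1"
        by (simp_all add: p0 p1 inner_complex_def)
      moreover have "Complex (2 * q j) 1 \<bullet> p k \<le> m\<^sup>2 + (q j)\<^sup>2" if "2 \<le> k" "k < n - 1" for k
        using tangent[OF that] by simp
      moreover have "- 2 / 3 * q j - 1 \<le> m\<^sup>2 + (q j)\<^sup>2"
        using q(1)[OF apex(2,3)] zero_le_power2[of m] zero_le_power2[of "q j"] by linarith
      ultimately have "?sep (Complex (2 * q j) 1)"
        using apex(1) q(1)[OF apex(2,3)] by (intro conjI all) auto
      then show ?thesis by blast
    next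
      case hub_1
      have "(q k)\<^sup>2 \<le> m\<^sup>2" if "2 \<le> k" "k < n - 1" for k
        using q[OF that] by (intro power_mono) auto
      then have "?sep (Complex 0 (- 1))"
        using hub_1 hub by (intro conjI all) (auto simp: p1 rim inner_complex_def)
      then show ?thesis by blast
    next
      case last
      have "0 < q (n - 2)"
        using n by (simp add: q_def)
      then have "?sep (Complex 1 0)"
        using last hub n by (intro conjI all) (auto simp: rim inner_complex_def)
      then show ?thesis by blast
    next
      case hub
      \<comment> \<open>With \<open>spoke i\<close> both \<open>p i\<close> and the hub would get
        the value 0; turning to the next rim vertex makes the inequality strict.\<close>
      have "?sep (spoke (i + 1))"
        using hub front[of i "i + 1"] behind[of "i + 1"] \<open>p (n - 1) = 0\<close> by (intro conjI all) auto
      then show ?thesis by blast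
    next
      case rim
      have "?sep (spoke j)"
        using rim front[of i j] behind[of j] spoke_rim[of j j] by (intro conjI all) auto
      then show ?thesis by blast
    next
      case rim_1
      have "4 * m \<le> m\<^sup>2"
        using m by (simp add: power2_eq_square)
      then have "0 < spoke 2 \<bullet> p (Suc 0)"
        unfolding spoke_1 using m by (simp add: q_def)
      then have "?sep (spoke 2)"
        using rim_1 behind[of 2] spoke_rim[of 2 2] n by (intro conjI all) auto
      then show ?thesis by blast
    next
      case close
      \<comment> \<open>The sign of the spoke is reversed here: vertex 1 lies behind the line
        through the hub and \<open>p j\<close>, the remaining rim vertices in front of it.\<close>
      have qj: "q j = m - 1"
        using close n by (simp add: q_def m_def)
      have "0 < - (spoke j \<bullet> p (Suc 0))"
        unfolding spoke_1 qj using m by (simp add: power2_eq_square field_simps)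
      moreover have "0 \<le> spoke j \<bullet> p k" if "2 \<le> k" "k < n - 1" for k
      proof (cases "k = j")
        case False
        then show ?thesis
          using that close front[of k j] by force
      qed (use that in \<open>simp add: spoke_rim\<close>)
      ultimately have "?sep (- spoke j)"
        using close spoke_rim[of j j] n by (intro conjI all) auto
      then show ?thesis by blast
    qed
  next
    fix i assume "Suc i < n"
    then show "\<exists>j. i < j \<and> j < n \<and>
        (i = 0 \<and> j < n - 1 \<or> 0 < i \<and> j = n - 1 \<or> 0 < i \<and> j = i + 1 \<and> j < n - 1 \<or> i = 1 \<and> j = n - 2)"
      using n by (cases "i = 0") (auto intro: exI[of _ 1] exI[of _ "n - 1"])
  qed
qed

lemma double_wheel_hub_rim:
  assumes "6 \<le> n" "x \<in> {0, n - 1}" "y < n" "y \<notin> {0, n - 1}"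
  shows "{x, y} \<in> edges (double_wheel n)"
  using assms by (auto simp: double_wheel_def ordered_graph_edge_iff)

lemma double_wheel_hubs:
  assumes "6 \<le> n" "x \<in> {0, n - 1}" "y \<in> {0, n - 1}"
  shows "{x, y} \<notin> edges (double_wheel n)"
  using assms by (auto simp: double_wheel_def ordered_graph_edge_iff)

text \<open>The rim is a cycle of length n - 2, which is at least 4, and so has no triangle.\<close>

lemma double_wheel_triangle:
  assumes n: "6 \<le> n" and e: "{x, y} \<in> edges (double_wheel n)" "{y, z} \<in> edges (double_wheel n)"
    "{x, z} \<in> edges (double_wheel n)"
  shows "x \<in> {0, n - 1} \<or> y \<in> {0, n - 1} \<or> z \<in> {0, n - 1}"
proof (rule ccontr)
  assume hubs: "\<not> ?thesis"
  \<comment> \<open>The outer pair \<open>a\<close>, \<open>c\<close> is not consecutive, so it is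
    the closing edge from 1 to \<open>n - 2\<close>; then \<open>b\<close> is 2 and \<open>c\<close>
    is 3, contrary to \<open>6 \<le> n\<close>.\<close>
  have increasing: False
    if "a < b" "b < c" and abc: "{a, b} \<in> edges (double_wheel n)" "{b, c} \<in> edges (double_wheel n)"
      "{a, c} \<in> edges (double_wheel n)" and nh: "a \<noteq> 0" "c \<noteq> n - 1" for a b c
  proof -
    have "b = a + 1 \<or> a = 1 \<and> b = n - 2"
      using \<open>a < b\<close> \<open>b < c\<close> abc(1) nh abc(2) by (auto simp: double_wheel_def ordered_graph_edge_iff)
    moreover have "c = b + 1 \<or> b = 1 \<and> c = n - 2"
      using \<open>a < b\<close> \<open>b < c\<close> abc(2) nh by (auto simp: double_wheel_def ordered_graph_edge_iff)
    moreover have "c = a + 1 \<or> a = 1 \<and> c = n - 2"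
      using \<open>a < b\<close> \<open>b < c\<close> abc(3) nh by (auto simp: double_wheel_def ordered_graph_edge_iff)
    ultimately show False
      using \<open>a < b\<close> \<open>b < c\<close> nh n by linarith
  qed
  have "x \<noteq> y" "y \<noteq> z" "x \<noteq> z"
    using e by (auto simp: double_wheel_def ordered_graph_def doubleton_eq_iff)
  then consider "x < y" "y < z" | "x < z" "z < y" | "y < x" "x < z" | "y < z" "z < x" | "z < x" "x < y" | "z < y" "y < x"
    by linarith
  then show False
    by cases (erule (1) increasing; use hubs e in \<open>simp add: insert_commute\<close>)+
qed

text \<open>Each of the four triangles of K4 contains a hub, so at least two of its vertices would
  be hubs; but the hubs are not adjacent.\<close>

lemma double_wheel_K4_free:
  assumes "6 \<le> n"
  shows "induced_free (complete_graph 4) (double_wheel n)"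
proof (rule induced_freeI)
  fix g assume "\<And>u v. u \<in> verts (complete_graph 4) \<Longrightarrow> v \<in> verts (complete_graph 4) \<Longrightarrow>
      {g u, g v} \<in> edges (double_wheel n) \<longleftrightarrow> {u, v} \<in> edges (complete_graph 4)"
  then have adj: "{g u, g v} \<in> edges (double_wheel n)" if "u < 4" "v < 4" "u \<noteq> v" for u v
    using that by (auto simp: complete_graph_def)
  let ?hub = "\<lambda>u. g u \<in> {0, n - 1}"
  have "?hub 0 \<or> ?hub 1 \<or> ?hub 2" "?hub 0 \<or> ?hub 1 \<or> ?hub 3" "?hub 0 \<or> ?hub 2 \<or> ?hub 3" "?hub 1 \<or> ?hub 2 \<or> ?hub 3"
    by (rule double_wheel_triangle[OF assms]; simp add: adj)+
  moreover have "\<not> (?hub u \<and> ?hub v)" if "u < 4" "v < 4" "u \<noteq> v" for u v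
    using double_wheel_hubs[OF assms] adj[OF that] by blast
  from this[of 0 1] this[of 0 2] this[of 0 3] this[of 1 2] this[of 1 3] this[of 2 3]
  have "\<not> (?hub 0 \<and> ?hub 1)" "\<not> (?hub 0 \<and> ?hub 2)" "\<not> (?hub 0 \<and> ?hub 3)"
    "\<not> (?hub 1 \<and> ?hub 2)" "\<not> (?hub 1 \<and> ?hub 3)" "\<not> (?hub 2 \<and> ?hub 3)"
    by simp_all
  ultimately show False by argo
qed

text \<open>One triangle contains a hub, and the other has a vertex that is no hub since the hubs
  are not adjacent. These two vertices are joined, which links the two triangles.\<close>

lemma double_wheel_2K3_free:
  assumes "6 \<le> n"
  shows "induced_free (disjoint_union (complete_graph 3) (complete_graph 3)) (double_wheel n)"
    (is "induced_free ?F _")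
proof (rule induced_freeI)
  fix g assume g: "g ` verts ?F \<subseteq> verts (double_wheel n)"
    and adj: "\<And>u v. u \<in> verts ?F \<Longrightarrow> v \<in> verts ?F \<Longrightarrow>
      {g u, g v} \<in> edges (double_wheel n) \<longleftrightarrow> {u, v} \<in> edges ?F"
  let ?hub = "\<lambda>u. g u \<in> {0, n - 1}"
  have verts: "Inl i \<in> verts ?F" "Inr i \<in> verts ?F" if "i < 3" for i
    using that by (auto simp: disjoint_union_def complete_graph_def)
  have l: "{Inl i, Inl j} \<in> edges ?F" and r: "{Inr i, Inr j} \<in> edges ?F" if "i < 3" "j < 3" "i \<noteq> j" for i j
  proof -
    have "{i, j} \<in> edges (complete_graph 3)"
      using that by (auto simp: complete_graph_def)
    then have "Inl ` {i, j} \<in> edges ?F" "Inr ` {i, j} \<in> edges ?F"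
      unfolding disjoint_union_def ugraph.select_convs by blast+
    then show "{Inl i, Inl j} \<in> edges ?F" "{Inr i, Inr j} \<in> edges ?F"
      by simp_all
  qed
  have "?hub (Inl 0) \<or> ?hub (Inl 1) \<or> ?hub (Inl 2)"
    by (rule double_wheel_triangle[OF assms]; simp add: adj verts l)
  then obtain i where i: "i < 3" "?hub (Inl i)"
    by (elim disjE) (erule that[rotated]; simp)+
  have "{g (Inr 0), g (Inr 1)} \<in> edges (double_wheel n)"
    by (simp add: adj verts r)
  then have "\<not> (?hub (Inr 0) \<and> ?hub (Inr 1))"
    using double_wheel_hubs[OF assms] by blast
  then have "\<not> ?hub (Inr 0) \<or> \<not> ?hub (Inr 1)" by blast
  then obtain j where j: "j < 3" "\<not> ?hub (Inr j)"
    by (elim disjE) (erule that[rotated]; simp)+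
  have "g (Inr j) < n"
    using g verts(2)[OF j(1)] by (auto simp: double_wheel_def)
  then have "{Inl i, Inr j} \<in> edges ?F"
    using double_wheel_hub_rim[OF assms i(2) _ j(2)] adj[OF verts(1)[OF i(1)] verts(2)[OF j(1)]] by simp
  moreover have "e \<subseteq> range Inl \<or> e \<subseteq> range Inr" if "e \<in> edges ?F" for e
    using that by (auto simp: disjoint_union_def)
  ultimately show False by fastforce
qed

section \<open>The extremal number\<close>

text \<open>The upper bound is the same for all \<open>F\<close>, so a single
  induced-\<open>F\<close>-free planar graph with 3n - 6 edges decides the value.\<close>

lemma ex_planar_ind_eqI:
  fixes G :: "nat ugraph"
 assumes "simple_graph G" "card (verts G) = n" "planar G" "induced_free F G"
    and "card (edges G) = 3 * n - 6" "3 \<le> n"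
  shows "ex_planar_ind n F = 3 * n - 6"
  unfolding ex_planar_ind_def
proof (rule Max_eqI[OF finite_ind_planar_sizes])
  show "3 * n - 6 \<in> ind_planar_sizes n F"
    unfolding ind_planar_sizes_def using assms by force
  fix m assume "m \<in> ind_planar_sizes n F"
  then obtain H :: "nat ugraph" where "simple_graph H" "card (verts H) = n" "planar H" "m = card (edges H)"
    by (auto simp: ind_planar_sizes_def)
  then show "m \<le> 3 * n - 6"
    using planar_edge_bound[of H] assms(6) by simp
qed

lemma ex_planar_ind_double_wheel:
  assumes "6 \<le> n" "induced_free F (double_wheel n)"
  shows "ex_planar_ind n F = 3 * n - 6"
  using assms(1)
  by (intro ex_planar_ind_eqI[OF _ _ planar_double_wheel assms(2) card_edges_double_wheel])
    (simp_all add: double_wheel_def simple_ordered_graph)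

theorem proposition1p1:
  fixes n :: nat
  assumes "n \<ge> 6"
  shows "(\<forall>k\<ge>4. ex_planar_ind n (cycle_graph k) = 3 * n - 6) \<and>
         ex_planar_ind n (star_graph 3) = 3 * n - 6 \<and>
         ex_planar_ind n (complete_graph 4) = 3 * n - 6 \<and>
         ex_planar_ind n (disjoint_union (complete_graph 3) (complete_graph 3)) = 3 * n - 6"
proof -
  have cube: "ex_planar_ind n F = 3 * n - 6" if "induced_free F (path_cube n)" for F :: "nat ugraph"
  proof (rule ex_planar_ind_eqI[OF _ _ planar_path_cube that])
    show "card (edges (path_cube n)) = 3 * n - 6"
      using assms by (intro card_edges_path_cube) simp
  qed (use assms in \<open>simp_all add: path_cube_def simple_ordered_graph\<close>)
  note wheel = ex_planar_ind_double_wheel[OF assms]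
  show ?thesis
    using cube path_cube_cycle_free path_cube_claw_free
      wheel[OF double_wheel_K4_free[OF assms]] wheel[OF double_wheel_2K3_free[OF assms]] by blast
qed

end
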